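(* Let $\mathcal{S}=\mathbb{R}/2\mathbb{Z}$ with the metric $\rho(x,y)=\min_{n\in\mathbb{Z}}|x-y-2n|$. For a positive integer $N$ let $\rho_N\big((x_i)_{i=1}^N,(y_i)_{i=1}^N\big)=\max_{1\le i\le N}\rho(x_i,y_i)$ on $\mathcal{S}^N$, and for $\delta>0$ let $$\mathcal{X}(\mathcal{S}^N,1,\delta)=\left\{(x_n)_{n\in\mathbb{Z}}\in(\mathcal{S}^N)^{\mathbb{Z}}:\ \rho_N(x_n,x_{n+1})\ge\delta\ \ \forall n\in\mathbb{Z}\right\},$$ with the left shift $\sigma$. Then for all integers $N\ge 2$ and all $0<\delta<1/2$, $$\lim_{p\to\infty}\mathrm{coind}_p\,P_p\big(\mathcal{X}(\mathcal{S}^N,1,\delta)\big)=\infty,$$ where $p$ runs over the prime numbers and $P_p\big(\mathcal{X}(\mathcal{S}^N,1,\delta)\big)=\{x\in\mathcal{X}(\mathcal{S}^N,1,\delta):\sigma^px=x\}$ is regarded as a free $\mathbb{Z}_p$-space via $\sigma$.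
   Context: Let $p$ be a prime and $\mathbb{Z}_p=\mathbb{Z}/p\mathbb{Z}$. A $\mathbb{Z}_p$-space is a pair $(X,T)$ with $X$ a topological space and $T:X\to X$ a homeomorphism with $T^p=\mathrm{id}$; it is free if $Tx\ne x$ for all $x\in X$ (equivalently, since $p$ is prime, $T^ax\neq x$ for all $1\le a\le p-1$ and $x\in X$). A map $f:(X,T)\to(Y,S)$ is equivariant if $f\circ T=S\circ f$. For $n\ge 0$, a free $\mathbb{Z}_p$-space $(X,T)$ is called an $E_n\mathbb{Z}_p$-space if $X$ is an $n$-dimensional finite simplicial complex, $T$ is a simplicial map (sending each simplex affinely to a simplex), and $X$ is $(n-1)$-connected, i.e. $\pi_k(X)=0$ for $0\le k\le n-1$ (for $n=0$, the finite set $\mathbb{Z}_p$ with its translation action is considered $(-1)$-connected and is an $E_0\mathbb{Z}_p$-space). For example, the $(n+1)$-fold join $(\mathbb{Z}_p)^{*(n+1)}$ with the simultaneous $\mathbb{Z}_p$-action on each factor is an $E_n\mathbb{Z}_p$-space. Any two $E_n\mathbb{Z}_p$-spaces admit equivariant continuous maps to each other in both directions, so the following does not depend on the choice of $E_n\mathbb{Z}_p$-space. The coindex of a free $\mathbb{Z}_p$-space $(X,T)$ is $$\mathrm{coind}_p(X,T)=\max\{n\ge 0:\ \text{there is an equivariant continuous map } E_n\mathbb{Z}_p\to X\},$$ abbreviated $\mathrm{coind}_p X$, with the convention $\mathrm{coind}_p\,\emptyset=-1$. $(\mathcal{S}^N)^{\mathbb{Z}}$ carries the product topology, and $\sigma((x_k)_{k\in\mathbb{Z}})=(x_{k+1})_{k\in\mathbb{Z}}$.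 The system $\mathcal{X}(\mathcal{S}^N,1,\delta)$ has no fixed point. *)

theory Defs
  imports "HOL-Analysis.Analysis"
begin

definition Zp_space :: "nat \<Rightarrow> 'a topology \<Rightarrow> ('a \<Rightarrow> 'a) \<Rightarrow> bool" where
  "Zp_space p X T \<longleftrightarrow>
     homeomorphic_map X X T \<and> (\<forall>x\<in>topspace X. (T ^^ p) x = x)"

definition free_Zp_space :: "nat \<Rightarrow> 'a topology \<Rightarrow> ('a \<Rightarrow> 'a) \<Rightarrow> bool" where
  "free_Zp_space p X T \<longleftrightarrow> Zp_space p X T \<and> (\<forall>x\<in>topspace X. T x \<noteq> x)"

definition equivariant_map ::
    "'a topology \<Rightarrow> ('a \<Rightarrow> 'a) \<Rightarrow> 'b topology \<Rightarrow> ('b \<Rightarrow> 'b) \<Rightarrow> ('a \<Rightarrow> 'b) \<Rightarrow> bool" where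
  "equivariant_map X T Y S f \<longleftrightarrow>
     continuous_map X Y f \<and> (\<forall>x\<in>topspace X. f (T x) = S (f x))"

text \<open>
  A finite simplicial complex is given by its vertices, which are natural numbers, and
  the set of its nonempty simplices. The library's \<open>simplicial_complex\<close> lives in a fixed
  Euclidean space, whose dimension cannot depend on the variable \<open>n\<close> below.
\<close>

definition finite_complex :: "nat set set \<Rightarrow> bool" where
  "finite_complex K \<longleftrightarrow>
     finite K \<and> (\<forall>s\<in>K. finite s \<and> s \<noteq> {}) \<and> (\<forall>s\<in>K. \<forall>t. t \<noteq> {} \<and> t \<subseteq> s \<longrightarrow> t \<in> K)"

definition has_dim :: "nat set set \<Rightarrow> nat \<Rightarrow> bool" where
  "has_dim K n \<longleftrightarrow> (\<exists>s\<in>K. card s = n + 1) \<and> (\<forall>s\<in>K. card s \<le> n + 1)"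

text \<open>Points of the geometric realization are given by barycentric coordinates.\<close>

definition support :: "(nat \<Rightarrow> real) \<Rightarrow> nat set" where
  "support x = {v. x v \<noteq> 0}"

definition realization :: "nat set set \<Rightarrow> (nat \<Rightarrow> real) set" where
  "realization K = {x. (\<forall>v. 0 \<le> x v) \<and> support x \<in> K \<and> (\<Sum>v\<in>support x. x v) = 1}"

definition closed_simplex :: "nat set set \<Rightarrow> nat set \<Rightarrow> (nat \<Rightarrow> real) set" where
  "closed_simplex K s = {x \<in> realization K. support x \<subseteq> s}"

text \<open>
  The topology on \<open>nat \<Rightarrow> real\<close> is the product topology; on the realization of a finite
  complex it is the Euclidean one.
\<close>

abbreviation realization_space :: "nat set set \<Rightarrow> (nat \<Rightarrow> real) topology" where
  "realization_space K \<equiv> top_of_set (realization K)"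

definition simplicial_self_map :: "nat set set \<Rightarrow> ((nat \<Rightarrow> real) \<Rightarrow> (nat \<Rightarrow> real)) \<Rightarrow> bool" where
  "simplicial_self_map K T \<longleftrightarrow>
     (\<forall>s\<in>K.
        (\<exists>s'\<in>K. T ` closed_simplex K s = closed_simplex K s') \<and>
        (\<forall>x\<in>closed_simplex K s. \<forall>y\<in>closed_simplex K s. \<forall>u\<in>{0..1}.
           T (\<lambda>v. (1 - u) * x v + u * y v) = (\<lambda>v. (1 - u) * T x v + u * T y v)))"

definition sphere_base :: "nat \<Rightarrow> real" where
  "sphere_base = (\<lambda>i. if i = 0 then 1 else 0)"

text \<open>\<open>trivial_homotopy k X\<close> says that \<open>\<pi>\<^sub>k(X, x\<^sub>0) = 0\<close> for all base points \<open>x\<^sub>0\<close>.\<close>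

definition trivial_homotopy :: "nat \<Rightarrow> 'a topology \<Rightarrow> bool" where
  "trivial_homotopy k X \<longleftrightarrow>
     (\<forall>x0\<in>topspace X. \<forall>f. continuous_map (nsphere k) X f \<and> f sphere_base = x0 \<longrightarrow>
        homotopic_with (\<lambda>h. h sphere_base = x0) (nsphere k) X f (\<lambda>_. x0))"

text \<open>
  A complex of dimension \<open>n\<close> is nonempty, so the last conjunct is
  \<open>(n - 1)\<close>-connectedness, with \<open>(-1)\<close>-connected meaning nonempty.
\<close>

definition E_space :: "nat \<Rightarrow> nat \<Rightarrow> nat set set \<Rightarrow> ((nat \<Rightarrow> real) \<Rightarrow> (nat \<Rightarrow> real)) \<Rightarrow> bool" where
  "E_space p n K T \<longleftrightarrow>
     finite_complex K \<and> has_dim K n \<and>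
     free_Zp_space p (realization_space K) T \<and>
     simplicial_self_map K T \<and>
     (\<forall>k<n. trivial_homotopy k (realization_space K))"

text \<open>
  All \<open>E_space\<close>s for the same \<open>p\<close> and \<open>n\<close> map equivariantly to each other, so it does not
  matter which one is used. The maximum is written as a supremum in the extended reals:
  it is the maximum if the set is bounded, and \<open>\<infinity>\<close> otherwise.
\<close>

definition coind :: "nat \<Rightarrow> 'a topology \<Rightarrow> ('a \<Rightarrow> 'a) \<Rightarrow> ereal" where
  "coind p X T =
     (if topspace X = {} then -1
      else Sup {ereal (real n) | n.
                  \<exists>K S f. E_space p n K S \<and> equivariant_map (realization_space K) S X T f})"

definition circ_rel :: "real \<Rightarrow> real \<Rightarrow> bool" where
  "circ_rel x y \<longleftrightarrow> (\<exists>n::int. x - y = 2 * of_int n)"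

quotient_type circ = real / circ_rel
proof (rule equivpI)
  show "reflp circ_rel"
    by (rule reflpI) (auto simp: circ_rel_def intro: exI[of _ 0])
  show "symp circ_rel"
  proof (rule sympI)
    fix x y assume "circ_rel x y"
    then obtain n :: int where "x - y = 2 * of_int n" by (auto simp: circ_rel_def)
    then have "y - x = 2 * of_int (- n)" by simp
    then show "circ_rel y x" unfolding circ_rel_def by blast
  qed
  show "transp circ_rel"
  proof (rule transpI)
    fix x y z assume "circ_rel x y" "circ_rel y z"
    then obtain n m :: int where "x - y = 2 * of_int n" "y - z = 2 * of_int m"
      by (auto simp: circ_rel_def)
    then have "x - z = 2 * of_int (n + m)" by simp
    then show "circ_rel x z" unfolding circ_rel_def by blast
  qed
qed

definition real_rho :: "real \<Rightarrow> real \<Rightarrow> real" where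
  "real_rho x y = (INF n::int. \<bar>x - y - 2 * of_int n\<bar>)"

lemma real_rho_le: "real_rho x y \<le> \<bar>x - y - 2 * of_int n\<bar>"
  unfolding real_rho_def by (rule cINF_lower) (auto intro!: bdd_belowI[of _ 0])

text \<open>The infimum is attained, so it is the minimum.\<close>

lemma real_rho_attained: "\<exists>n::int. real_rho x y = \<bar>x - y - 2 * of_int n\<bar>"
proof
  let ?n = "round ((x - y) / 2)"
  have "\<bar>x - y - 2 * of_int ?n\<bar> \<le> \<bar>x - y - 2 * of_int m\<bar>" for m :: int
  proof -
    have "\<bar>(x - y) / 2 - of_int ?n\<bar> \<le> \<bar>(x - y) / 2 - of_int m\<bar>"
      by (rule round_diff_minimal)
    moreover have "x - y - 2 * of_int k = 2 * ((x - y) / 2 - of_int k)" for k :: int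
      by (simp add: field_simps)
    ultimately show ?thesis by (simp only: abs_mult) simp
  qed
  then have "\<bar>x - y - 2 * of_int ?n\<bar> \<le> real_rho x y"
    unfolding real_rho_def by (intro cINF_greatest) auto
  then show "real_rho x y = \<bar>x - y - 2 * of_int ?n\<bar>"
    using real_rho_le[of x y ?n] by simp
qed

lemma real_rho_cong:
  assumes "circ_rel x x'" "circ_rel y y'"
  shows "real_rho x y = real_rho x' y'"
proof -
  have le: "real_rho a b \<le> real_rho a' b'"
    if a: "a - a' = 2 * of_int k" and b: "b - b' = 2 * of_int l" for a a' b b' :: real and k l :: int
  proof -
    obtain n :: int where n: "real_rho a' b' = \<bar>a' - b' - 2 * of_int n\<bar>"
      using real_rho_attained by blast
    have "a - b - 2 * of_int (n + k - l) = a' - b' - 2 * of_int n"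
      using a b by (simp add: algebra_simps)
    then show ?thesis using real_rho_le[of a b "n + k - l"] n by simp
  qed
  obtain k l :: int where kl: "x - x' = 2 * of_int k" "y - y' = 2 * of_int l"
    using assms by (auto simp: circ_rel_def)
  have "x' - x = 2 * of_int (- k)" "y' - y = 2 * of_int (- l)"
    using kl by simp_all
  then show ?thesis using le[OF kl] le[of x' x "- k" y' y "- l"] by simp
qed

text \<open>
  The metric \<open>\<rho>\<close> becomes \<open>dist\<close> on \<^typ>\<open>circ\<close>; it induces the quotient topology.
\<close>

instantiation circ :: metric_space
begin

lift_definition dist_circ :: "circ \<Rightarrow> circ \<Rightarrow> real" is real_rho
  by (rule real_rho_cong)

definition uniformity_circ :: "(circ \<times> circ) filter" where
  "uniformity_circ = (INF e\<in>{0<..}. principal {(x, y). dist x y < e})"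

definition open_circ :: "circ set \<Rightarrow> bool" where
  "open_circ U \<longleftrightarrow> (\<forall>x\<in>U. \<forall>\<^sub>F (x', y) in uniformity. x' = x \<longrightarrow> y \<in> U)"

instance
proof
  show "uniformity = (INF e\<in>{0<..}. principal {(x :: circ, y). dist x y < e})"
    by (rule uniformity_circ_def)
  show "open U \<longleftrightarrow> (\<forall>x\<in>U. \<forall>\<^sub>F (x', y) in uniformity. x' = x \<longrightarrow> y \<in> U)" for U :: "circ set"
    by (rule open_circ_def)
  show "dist x y = 0 \<longleftrightarrow> x = y" for x y :: circ
  proof (transfer)
    fix x y :: real
    show "real_rho x y = 0 \<longleftrightarrow> circ_rel x y"
    proof
      assume "real_rho x y = 0"
      moreover obtain n :: int where "real_rho x y = \<bar>x - y - 2 * of_int n\<bar>"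
        using real_rho_attained by blast
      ultimately have "x - y = 2 * of_int n" by simp
      then show "circ_rel x y" unfolding circ_rel_def by blast
    next
      assume "circ_rel x y"
      then obtain n :: int where "x - y = 2 * of_int n" by (auto simp: circ_rel_def)
      then have "real_rho x y \<le> 0" using real_rho_le[of x y n] by simp
      moreover have "0 \<le> real_rho x y"
        using real_rho_attained[of x y] by auto
      ultimately show "real_rho x y = 0" by simp
    qed
  qed
  show "dist x y \<le> dist x z + dist y z" for x y z :: circ
  proof (transfer)
    fix x y z :: real
    obtain n m :: int where n: "real_rho x z = \<bar>x - z - 2 * of_int n\<bar>"
      and m: "real_rho y z = \<bar>y - z - 2 * of_int m\<bar>"
      using real_rho_attained by blast
    have "real_rho x y \<le> \<bar>x - y - 2 * of_int (n - m)\<bar>"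
      by (rule real_rho_le)
    also have "\<dots> \<le> real_rho x z + real_rho y z"
      unfolding n m by simp
    finally show "real_rho x y \<le> real_rho x z + real_rho y z" .
  qed
qed

end

text \<open>
  \<open>\<S>\<^sup>N\<close> is \<open>circ ^ 'n\<close> with \<open>CARD('n) = N\<close>. Its library metric is the \<open>\<ell>\<^sup>2\<close> one, so the maximum
  metric is defined separately; both induce the product topology.
\<close>

definition rhoN :: "circ ^ 'n \<Rightarrow> circ ^ 'n \<Rightarrow> real" where
  "rhoN x y = Max (range (\<lambda>i. dist (x $ i) (y $ i)))"

definition XS :: "real \<Rightarrow> (int \<Rightarrow> circ ^ 'n) set" where
  "XS \<delta> = {x. \<forall>n. rhoN (x n) (x (n + 1)) \<ge> \<delta>}"

definition left_shift :: "(int \<Rightarrow> 'a) \<Rightarrow> (int \<Rightarrow> 'a)" where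
  "left_shift x = (\<lambda>k. x (k + 1))"

definition periodic_points :: "nat \<Rightarrow> (int \<Rightarrow> 'a) set \<Rightarrow> (int \<Rightarrow> 'a) set" where
  "periodic_points p X = {x \<in> X. (left_shift ^^ p) x = x}"

lemma left_shift_funpow: "(left_shift ^^ m) x = (\<lambda>k. x (k + int m))"
  by (induction m) (auto simp: left_shift_def algebra_simps)

lemma free_Zp_space_periodic_points:
  assumes "\<delta> > 0"
  shows "free_Zp_space p (top_of_set (periodic_points p (XS \<delta> :: (int \<Rightarrow> circ ^ 'n) set))) left_shift"
proof -
  let ?P = "periodic_points p (XS \<delta> :: (int \<Rightarrow> circ ^ 'n) set)"
  let ?g = "\<lambda>(x :: int \<Rightarrow> circ ^ 'n) k. x (k - 1)"
  have cont: "continuous_on A (\<lambda>(x :: int \<Rightarrow> circ ^ 'n) k. x (h k))" for A h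
    by (intro continuous_on_coordinatewise_then_product)
       (rule continuous_on_product_coordinates[THEN continuous_on_subset], simp)
  have maps: "left_shift x \<in> ?P" if "x \<in> ?P" for x
  proof -
    have per: "x (k + int p) = x k" for k
      using that by (simp add: periodic_points_def left_shift_funpow fun_eq_iff)
    have sep: "rhoN (x k) (x (k + 1)) \<ge> \<delta>" for k
      using that by (simp add: periodic_points_def XS_def)
    have "x (k + 1 + int p) = x (k + 1)" "\<delta> \<le> rhoN (x (k + 1)) (x (k + 1 + 1))" for k
      using per sep by blast+
    then show ?thesis
      by (simp add: periodic_points_def XS_def left_shift_funpow left_shift_def fun_eq_iff ac_simps)
  qed
  have mapsg: "?g x \<in> ?P" if "x \<in> ?P" for x
  proof -
    have per: "x (k + int p) = x k" for k
      using that by (simp add: periodic_points_def left_shift_funpow fun_eq_iff)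
    have sep: "rhoN (x k) (x (k + 1)) \<ge> \<delta>" for k
      using that by (simp add: periodic_points_def XS_def)
    have "x (k - 1 + int p) = x (k - 1)" "\<delta> \<le> rhoN (x (k - 1)) (x (k - 1 + 1))" for k
      using per sep by blast+
    then show ?thesis
      by (simp add: periodic_points_def XS_def left_shift_funpow fun_eq_iff algebra_simps)
  qed
  have "homeomorphic_maps (top_of_set ?P) (top_of_set ?P) left_shift ?g"
    unfolding homeomorphic_maps_def
    using cont[of ?P "\<lambda>k. k + 1"] cont[of ?P "\<lambda>k. k - 1"] maps mapsg
    by (auto simp: left_shift_def[abs_def])
  then have "homeomorphic_map (top_of_set ?P) (top_of_set ?P) left_shift"
    by (rule homeomorphic_maps_imp_map)
  moreover have "left_shift x \<noteq> x" if "x \<in> ?P" for x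
  proof
    assume "left_shift x = x"
    then have "x (0 + 1) = x 0" unfolding left_shift_def by (rule fun_cong)
    moreover have "\<delta> \<le> rhoN (x 0) (x (0 + 1))"
      using that by (simp only: periodic_points_def XS_def mem_Collect_eq)
    ultimately show False using assms by (simp add: rhoN_def)
  qed
  ultimately show ?thesis
    by (auto simp: free_Zp_space_def Zp_space_def periodic_points_def)
qed

end

(*
  Take for the E_n-space the n-skeleton K of the simplex with vertex set Z_p, on which Z_p acts by
  rotation.

  Equivariant map. Let a(x) = exp(i pi sum_v v x_v). Rotating x changes the sign of a(x) unless the
  vertex 0 lies in the support of x, so along an orbit all but n + 1 consecutive terms cancel and the
  orbit mean of a has modulus at most (n + 1)/p. Subtracting the mean gives w: K -> C with orbit sums
  0 and | |w| - 1 | <= 1/4, which is a coboundary w(x) = F(Tx) - F(x). Using Re F and Im F as two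
  coordinates modulo 2, consecutive points of the orbit are at distance at least
  (3/4)/sqrt 2 > 1/2 > delta.

  Connectivity. Extend a map from S^k, k < n, coordinatewise to a cube of dimension k + 1 <= n and
  perturb the extension so that no n + 2 of its coordinate functions ever agree. The (n + 2)-nd
  largest coordinate is then smaller than the largest one, and subtracting it and truncating at 0
  retracts onto the n-skeleton.
*)

theory Submission
  imports Defs
begin

section \<open>Functions on a cube with few coincidences\<close>

definition clamp01 :: "real \<Rightarrow> real" where
  "clamp01 t = max 0 (min 1 t)"

text \<open>Truncation to \<open>[0, R]\<close> is cut into unit ramps, which
  \<open>snapping_maps\<close> steepens one by one.\<close>

lemma sum_clamp01: "(\<Sum>m<R. clamp01 (u - real m)) = max 0 (min u (real R))"
  by (induction R) (auto simp: clamp01_def)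

text \<open>Each \<open>s i\<close> is a staircase near the identity, with treads at heights in
  \<open>D\<close> and risers over intervals reserved for \<open>i\<close>. Risers of different
  indices are disjoint, so at each \<open>t\<close> at most one index is off
  \<open>D\<close>.\<close>

lemma snapping_maps:
  fixes p :: nat and \<tau> :: real
  assumes "0 < \<tau>"
  obtains s :: "nat \<Rightarrow> real \<Rightarrow> real" and D where
    "finite D"
    "\<And>i. continuous_on UNIV (s i)"
    "\<And>i t. i < p \<Longrightarrow> t \<in> {-1..1} \<Longrightarrow> s i t \<in> {-1..1} \<and> \<bar>s i t - t\<bar> \<le> \<tau>"
    "\<And>i j t. i < p \<Longrightarrow> j < p \<Longrightarrow> s i t \<notin> D \<Longrightarrow> s j t \<notin> D \<Longrightarrow> i = j"
proof -
  obtain R :: nat where R: "2 / \<tau> < real R" using reals_Archimedean2 by blast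
  have R0: "0 < real R" using R assms by (meson divide_pos_pos less_trans zero_less_numeral)
  \<comment> \<open>In the coordinate \<open>u = (t + 1) / h\<close> the interval
    \<open>[-1, 1]\<close> becomes \<open>[0, R]\<close>, and an error of 1 in \<open>u\<close> is
    an error of \<open>h\<close> in \<open>t\<close>.\<close>
  define h where "h = 2 / real R"
  have h0: "0 < h" and h\<tau>: "h \<le> \<tau>" and hR: "h * real R = 2"
    using R R0 assms by (auto simp: h_def field_simps)
  \<comment> \<open>Unit ramp \<open>m\<close> is compressed to slope \<open>p\<close> and rises
    only between \<open>m + i/p\<close> and \<open>m + (i+1)/p\<close>.\<close>
  define c where "c i u m = clamp01 (real p * (u - real m) - real i)" for i :: nat and u and m :: nat
  define s where "s i t = -1 + h * (\<Sum>m<R. c i ((t + 1) / h) m)" for i t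
  define D where "D = (\<lambda>k. -1 + h * real k) ` {..R}"
  show thesis
  proof
    show "finite D" by (simp add: D_def)
    show "continuous_on UNIV (s i)" for i
      unfolding s_def c_def clamp01_def using h0 by (intro continuous_intros) auto
    show "s i t \<in> {-1..1} \<and> \<bar>s i t - t\<bar> \<le> \<tau>" if i: "i < p" and t: "t \<in> {-1..1}" for i t
    proof -
      define u where "u = (t + 1) / h"
      have u: "0 \<le> u" "u \<le> real R" using t h0 hR by (auto simp: u_def field_simps)
      have tu: "t = -1 + h * u" using h0 by (simp add: u_def)
      \<comment> \<open>A compressed ramp lies between the unit ramps shifted by 1 to either side;
        summing with \<open>sum_clamp01\<close> bounds the displacement of \<open>u\<close> by
        1.\<close>
      have b: "clamp01 (u - 1 - real m) \<le> c i u m \<and> c i u m \<le> clamp01 (u + 1 - real m)" for m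
      proof -
        consider "u - real m \<le> 0" | "0 < u - real m" "u - real m < 1" | "1 \<le> u - real m"
          by linarith
        then show ?thesis
        proof cases
          case 1
          then have "real p * (u - real m) \<le> 0" by (simp add: mult_nonneg_nonpos)
          then show ?thesis using 1 by (auto simp: c_def clamp01_def)
        next
          case 3
          then have "real p * 1 \<le> real p * (u - real m)" by (intro mult_left_mono) auto
          moreover have "real i + 1 \<le> real p" using i by linarith
          ultimately have "1 \<le> real p * (u - real m) - real i" by linarith
          then show ?thesis using 3 by (simp add: c_def clamp01_def)
        qed (auto simp: c_def clamp01_def)
      qed
      have "(\<Sum>m<R. clamp01 (u - 1 - real m)) \<le> (\<Sum>m<R. c i u m)"
        "(\<Sum>m<R. c i u m) \<le> (\<Sum>m<R. clamp01 (u + 1 - real m))"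
        using b by (auto intro: sum_mono)
      then have S: "\<bar>(\<Sum>m<R. c i u m) - u\<bar> \<le> 1" unfolding sum_clamp01 using u by linarith
      have "s i t - t = h * ((\<Sum>m<R. c i u m) - u)"
        unfolding s_def u_def[symmetric] tu by (simp add: algebra_simps)
      then have "\<bar>s i t - t\<bar> \<le> h * 1"
        using S h0 by (simp only: abs_mult) (intro mult_mono, auto)
      moreover have "0 \<le> (\<Sum>m<R. c i u m)" "(\<Sum>m<R. c i u m) \<le> real R"
        using sum_bounded_above[of "{..<R}" "c i u" 1]
        by (auto intro!: sum_nonneg simp: c_def clamp01_def)
      then have "0 \<le> h * (\<Sum>m<R. c i u m)" "h * (\<Sum>m<R. c i u m) \<le> h * real R"
        using h0 by (auto intro: mult_left_mono)
      ultimately show ?thesis using h\<tau> hR by (auto simp: s_def u_def)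
    qed
    \<comment> \<open>the thick grid of index \<open>i\<close> is \<open>\<Union>m. (m + i/p, m + (i+1)/p)\<close>; these are disjoint\<close>
    have off: "\<exists>m. \<lfloor>real p * u\<rfloor> = int (p * m + i)"
      if "s i t \<notin> D" "u = (t + 1) / h" for i t u
    proof (rule ccontr)
      assume no: "\<not> ?thesis"
      \<comment> \<open>Off the risers every ramp is 0 or 1, so the sum counts completed ramps and
        \<open>s i t\<close> is a height in \<open>D\<close>.\<close>
      have "c i u m \<in> {0, 1}" for m
      proof (rule ccontr)
        assume "c i u m \<notin> {0, 1}"
        then have "0 < real p * (u - real m) - real i" "real p * (u - real m) - real i < 1"
          by (auto simp: c_def clamp01_def max_def min_def split: if_splits)
        then have "\<lfloor>real p * u\<rfloor> = int (p * m + i)"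
          by (intro floor_unique) (auto simp: algebra_simps)
        then show False using no by blast
      qed
      then have c01: "c i u m = of_bool (c i u m = 1)" for m by auto
      have "(\<Sum>m<R. c i u m) = (\<Sum>m<R. of_bool (c i u m = 1))"
        by (rule sum.cong) (use c01 in auto)
      also have "\<dots> = real (card {m\<in>{..<R}. c i u m = 1})"
        by (subst sum_of_bool_eq) (auto simp: Int_def)
      finally have S: "(\<Sum>m<R. c i u m) = real (card {m\<in>{..<R}. c i u m = 1})" .
      have "card {m\<in>{..<R}. c i u m = 1} \<le> R"
        using card_mono[of "{..<R}" "{m\<in>{..<R}. c i u m = 1}"] by auto
      then have "s i t \<in> D" unfolding D_def s_def that(2)[symmetric] S by blast
      then show False using that by blast
    qed
    show "i = j" if "i < p" "j < p" and on: "s i t \<notin> D" "s j t \<notin> D" for i j t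
    proof -
      \<comment> \<open>The index is the residue of \<open>\<lfloor>real p * u\<rfloor>\<close>
        modulo \<open>p\<close>.\<close>
      obtain m n where "int (p * m + i) = int (p * n + j)"
        using off[OF on(1) refl] off[OF on(2) refl] by metis
      then have "(p * m + i) mod p = (p * n + j) mod p" by (simp only: of_nat_eq_iff)
      then show ?thesis using that by simp
    qed
  qed
qed

section \<open>Perturbation of functions on the cube\<close>

text \<open>Padding by zeros lets \<open>d\<close> vary and puts the cube in the type in which
  \<open>nsphere\<close> lives.\<close>

definition cube :: "nat \<Rightarrow> (nat \<Rightarrow> real) set" where
  "cube d = {y. (\<forall>j<d. y j \<in> {-1..1}) \<and> (\<forall>j\<ge>d. y j = 0)}"

lemma compact_cube: "compact (cube d)"
proof -
  have "cube d = (\<Pi>\<^sub>E i\<in>UNIV. if i < d then {-1..1} else {0})"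
    by (auto simp: cube_def PiE_iff split: if_splits)
  moreover have "compactin (product_topology (\<lambda>i. euclideanreal) UNIV)
      (\<Pi>\<^sub>E i\<in>UNIV. if i < d then {-1..1} else {0})"
    unfolding compactin_PiE by (auto simp: compactin_euclidean_iff)
  ultimately show ?thesis by (simp add: euclidean_product_topology compactin_euclidean_iff)
qed

text \<open>The metric on functions weights the enumerated coordinates by powers of 1/2, of total
  weight 2.\<close>

lemma dist_fun_le:
  fixes x y :: "nat \<Rightarrow> real"
  assumes "\<And>j. \<bar>x j - y j\<bar> \<le> \<tau>"
  shows "dist x y \<le> 2 * \<tau>"
proof (rule LIMSEQ_le_const)
  show "(\<lambda>N. 2 * \<tau> + (1/2::real) ^ N) \<longlonglongrightarrow> 2 * \<tau>"
    by (auto intro!: tendsto_eq_intros LIMSEQ_power_zero)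
  have "dist x y \<le> 2 * \<tau> + (1/2) ^ N" for N
  proof -
    let ?S = "{dist (x (from_nat n)) (y (from_nat n)) |n. n \<le> N}"
    have "?S = (\<lambda>n. dist (x (from_nat n)) (y (from_nat n))) ` {..N}" by auto
    then have "Max ?S \<le> \<tau>" using assms by (auto simp: dist_real_def)
    then show ?thesis using dist_fun_le_dist_first_terms[of x y N] by linarith
  qed
  then show "\<exists>N. \<forall>n\<ge>N. dist x y \<le> 2 * \<tau> + (1/2) ^ n" by blast
qed

text \<open>The translations are multiples of a step so small that their differences stay below
  every nonzero difference of the given values. Equality after translation then forces
  \<open>a = b\<close>, hence equal translations.\<close>

lemma separating_translations:
  fixes A :: "nat \<Rightarrow> real set"
  assumes "\<And>i. finite (A i)" and "0 < \<epsilon>"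
  obtains v where "\<And>i. i < p \<Longrightarrow> 0 \<le> v i \<and> v i < \<epsilon>"
    "\<And>i j a b. i < p \<Longrightarrow> j < p \<Longrightarrow> a \<in> A i \<Longrightarrow> b \<in> A j \<Longrightarrow> a + v i = b + v j \<Longrightarrow> i = j"
proof -
  define W where "W = (\<Union>i<p. \<Union>j<p. (\<lambda>(a, b). b - a) ` (A i \<times> A j))"
  have "finite W" unfolding W_def using assms by auto
  then obtain d where d: "d > 0" "\<And>w. w \<in> W \<Longrightarrow> w \<noteq> 0 \<Longrightarrow> d \<le> dist 0 w"
    using finite_set_avoid by metis
  \<comment> \<open>Dividing by \<open>p + 1\<close> keeps \<open>x * t\<close> strictly below both
    bounds for all \<open>x \<le> p\<close>.\<close>
  define t where "t = min d \<epsilon> / (real p + 1)"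
  have t0: "0 < t" using d assms by (simp add: t_def)
  have t: "x * t < d \<and> x * t < \<epsilon>" if "0 \<le> x" "x \<le> real p" for x
  proof -
    have "x * t < (real p + 1) * t" using that t0 by (intro mult_strict_right_mono) auto
    also have "\<dots> = min d \<epsilon>" by (simp add: t_def add_nonneg_eq_0_iff)
    finally show ?thesis by simp
  qed
  show thesis
  proof
    show "0 \<le> real i * t \<and> real i * t < \<epsilon>" if "i < p" for i using t0 t[of "real i"] that by simp
    fix i j a b
    assume *: "i < p" "j < p" "a \<in> A i" "b \<in> A j" "a + real i * t = b + real j * t"
    then have "b - a \<in> W" unfolding W_def by force
    moreover have e: "b - a = (real i - real j) * t" using * by (simp add: algebra_simps)
    moreover have "\<bar>b - a\<bar> < d"
      unfolding e abs_mult using t[of "\<bar>real i - real j\<bar>"] t0 * by auto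
    ultimately have "b - a = 0" using d(2)[of "b - a"] by (force simp: dist_real_def)
    then show "i = j" using e t0 by simp
  qed
qed

text \<open>
  Composing the \<open>i\<close>-th function with a map of the cube that is locally constant off a thick grid
  depending on \<open>i\<close> makes it finite-valued off that grid. The grids are so placed that a point lies on at most
  \<open>d\<close> of them, and the finitely many values are made distinct by translations.
\<close>

lemma few_coincidences:
  fixes F :: "nat \<Rightarrow> (nat \<Rightarrow> real) \<Rightarrow> real"
  assumes F: "\<And>i. continuous_on (cube d) (F i)" and "0 < \<epsilon>"
  obtains G where "\<And>i. i < p \<Longrightarrow> continuous_on (cube d) (G i)"
    "\<And>i y. i < p \<Longrightarrow> y \<in> cube d \<Longrightarrow> \<bar>G i y - F i y\<bar> < \<epsilon>"
    "\<And>y a. y \<in> cube d \<Longrightarrow> card {i. i < p \<and> G i y = a} \<le> d + 1"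
proof -
  have "\<exists>\<eta>>0. \<forall>x\<in>cube d. \<forall>y\<in>cube d. dist x y < \<eta> \<longrightarrow> dist (F i x) (F i y) < \<epsilon> / 2" for i
    using compact_uniformly_continuous[OF F compact_cube, of i] \<open>0 < \<epsilon>\<close>
    unfolding uniformly_continuous_on_def by (metis dist_commute half_gt_zero)
  then obtain \<eta> where \<eta>: "\<And>i. \<eta> i > 0"
    "\<And>i x y. x \<in> cube d \<Longrightarrow> y \<in> cube d \<Longrightarrow> dist x y < \<eta> i \<Longrightarrow> \<bar>F i x - F i y\<bar> < \<epsilon> / 2"
    by (simp only: dist_real_def) metis
  define \<eta>0 where "\<eta>0 = Min (insert 1 (\<eta> ` {..<p}))"
  have \<eta>0: "0 < \<eta>0" "\<And>i. i < p \<Longrightarrow> \<eta>0 \<le> \<eta> i" using \<eta> by (auto simp: \<eta>0_def)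
  \<comment> \<open>\<open>dist_fun_le\<close> doubles the coordinatewise error, and two thirds of
    \<open>\<eta>0\<close> is still strictly below each \<open>\<eta> i\<close>.\<close>
  have "0 < \<eta>0 / 3" using \<eta>0 by simp
  then obtain s D where s: "finite D" "\<And>i. continuous_on UNIV (s i)"
    "\<And>i t. i < p \<Longrightarrow> t \<in> {-1..1} \<Longrightarrow> s i t \<in> {-1..1} \<and> \<bar>s i t - t\<bar> \<le> \<eta>0 / 3"
    "\<And>i j t. i < p \<Longrightarrow> j < p \<Longrightarrow> s i t \<notin> D \<Longrightarrow> s j t \<notin> D \<Longrightarrow> i = j"
    using snapping_maps[of "\<eta>0 / 3" p] by metis
  define c where "c i y = (\<lambda>j. if j < d then s i (y j) else 0)" for i and y :: "nat \<Rightarrow> real"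
  define L where "L = {y :: nat \<Rightarrow> real. \<forall>j. (j \<in> {..<d} \<longrightarrow> y j \<in> D) \<and> (j \<notin> {..<d} \<longrightarrow> y j = 0)}"
  have finL: "finite L" unfolding L_def by (rule finite_set_of_finite_funs) (use s in auto)
  have c_cube: "c i y \<in> cube d" if "i < p" "y \<in> cube d" for i y
    using that s(3)[of i] by (auto simp: c_def cube_def)
  have c_near: "dist (c i y) y < \<eta> i" if "i < p" "y \<in> cube d" for i y
  proof -
    have "\<bar>c i y j - y j\<bar> \<le> \<eta>0 / 3" for j
      using that s(3)[of i "y j"] \<eta>0 by (auto simp: c_def cube_def)
    then have "dist (c i y) y \<le> 2 * (\<eta>0 / 3)" by (rule dist_fun_le)
    then show ?thesis using \<eta>0 \<eta>0(2)[of i] that by linarith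
  qed
  have c_cont: "continuous_on X (c i)" for X i
  proof (rule continuous_on_coordinatewise_then_product)
    fix j
    have "continuous_on X (\<lambda>y. s i (y j))"
      by (rule continuous_on_compose2[OF s(2)])
        (auto intro: continuous_on_subset[OF continuous_on_product_coordinates])
    then show "continuous_on X (\<lambda>y. c i y j)" by (cases "j < d") (simp_all add: c_def)
  qed
  \<comment> \<open>Each of the \<open>d\<close> coordinates is off \<open>D\<close> for at most one
    index.\<close>
  have off: "card {i. i < p \<and> c i y \<notin> L} \<le> d" for y
  proof -
    have "{i. i < p \<and> c i y \<notin> L} \<subseteq> (\<Union>j<d. {i. i < p \<and> s i (y j) \<notin> D})"
      by (auto simp: c_def L_def)
    then have "card {i. i < p \<and> c i y \<notin> L} \<le> card (\<Union>j<d. {i. i < p \<and> s i (y j) \<notin> D})"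
      by (intro card_mono) auto
    also have "\<dots> \<le> (\<Sum>j<d. card {i. i < p \<and> s i (y j) \<notin> D})" by (rule card_UN_le) simp
    also have "\<dots> \<le> (\<Sum>j<d. 1)"
    proof (rule sum_mono)
      fix j
      show "card {i. i < p \<and> s i (y j) \<notin> D} \<le> 1"
        using s(4) by (subst card_le_Suc0_iff_eq[unfolded One_nat_def[symmetric]]) auto
    qed
    finally show ?thesis by simp
  qed
  have "finite (F i ` L)" for i using finL by simp
  then obtain v where v: "\<And>i. i < p \<Longrightarrow> 0 \<le> v i \<and> v i < \<epsilon> / 2"
    "\<And>i j a b. i < p \<Longrightarrow> j < p \<Longrightarrow> a \<in> F i ` L \<Longrightarrow> b \<in> F j ` L \<Longrightarrow> a + v i = b + v j \<Longrightarrow> i = j"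
    using separating_translations[of "\<lambda>i. F i ` L" "\<epsilon> / 2" p] \<open>0 < \<epsilon>\<close> by (metis half_gt_zero)
  define G where "G i y = F i (c i y) + v i" for i y
  show thesis
  proof
    show "continuous_on (cube d) (G i)" if "i < p" for i
      unfolding G_def
      by (intro continuous_intros continuous_on_compose2[OF F c_cont]) (use c_cube that in auto)
    show "\<bar>G i y - F i y\<bar> < \<epsilon>" if "i < p" "y \<in> cube d" for i y
      using \<eta>(2)[OF c_cube[OF that] that(2) c_near[OF that]] v(1)[OF that(1)]
      unfolding G_def by linarith
    show "card {i. i < p \<and> G i y = a} \<le> d + 1" if "y \<in> cube d" for y a
    proof -
      \<comment> \<open>Indices with \<open>c i y \<in> L\<close> take pairwise distinct values, so
        at most one of them takes the value \<open>a\<close>; the remaining indices number at most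
        \<open>d\<close>.\<close>
      have "i = j" if "i < p" "j < p" "c i y \<in> L" "c j y \<in> L" "G i y = G j y" for i j
        using v(2)[OF that(1,2) imageI[OF that(3)] imageI[OF that(4)]] that(5) by (simp add: G_def)
      then have "card {i. i < p \<and> c i y \<in> L \<and> G i y = a} \<le> 1"
        by (subst card_le_Suc0_iff_eq[unfolded One_nat_def[symmetric]]) auto
      moreover have "card {i. i < p \<and> G i y = a}
          \<le> card ({i. i < p \<and> c i y \<notin> L} \<union> {i. i < p \<and> c i y \<in> L \<and> G i y = a})"
        by (intro card_mono) auto
      ultimately show ?thesis
        using off[of y] card_Un_le[of "{i. i < p \<and> c i y \<notin> L}" "{i. i < p \<and> c i y \<in> L \<and> G i y = a}"]
        by linarith
    qed
  qed
qed

section \<open>Connectivity of skeletons of a simplex\<close>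

text \<open>For \<open>m < p\<close> this is the \<open>(m + 1)\<close>-st largest of the numbers \<open>x 0, \<dots>, x (p - 1)\<close>.\<close>

definition nth_largest :: "nat \<Rightarrow> nat \<Rightarrow> (nat \<Rightarrow> real) \<Rightarrow> real" where
  "nth_largest p m x =
     Min ((\<lambda>J. Max (x ` ({..<p} - J))) ` {J. J \<subseteq> {..<p} \<and> card J = m})"

lemma finite_choices: "finite {J. J \<subseteq> {..<p::nat} \<and> card J = m}"
  by (rule finite_subset[of _ "Pow {..<p}"]) auto

lemma choices_nonempty:
  assumes "m \<le> p"
  shows "{J. J \<subseteq> {..<p} \<and> card J = m} \<noteq> {}"
  using assms by (auto intro!: exI[of _ "{..<m}"])

lemma choice_compl_nonempty:
  assumes "m < p" "J \<subseteq> {..<p}" "card J = m"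
  shows "{..<p} - J \<noteq> {}"
  using assms by auto

lemma nth_largest_le:
  assumes "m < p" "J \<subseteq> {..<p}" "card J = m" "\<And>i. i < p \<Longrightarrow> i \<notin> J \<Longrightarrow> x i \<le> a"
  shows "nth_largest p m x \<le> a"
proof -
  have "nth_largest p m x \<le> Max (x ` ({..<p} - J))"
    unfolding nth_largest_def using assms finite_choices by (intro Min_le) auto
  also have "\<dots> \<le> a" using assms choice_compl_nonempty[of m p J] by (subst Max_le_iff) auto
  finally show ?thesis .
qed

lemma nth_largest_attained:
  assumes "m < p"
  obtains J where "J \<subseteq> {..<p}" "card J = m" "\<And>i. i < p \<Longrightarrow> i \<notin> J \<Longrightarrow> x i \<le> nth_largest p m x"
    "nth_largest p m x \<in> x ` ({..<p} - J)"
proof -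
  have "nth_largest p m x \<in> (\<lambda>J. Max (x ` ({..<p} - J))) ` {J. J \<subseteq> {..<p} \<and> card J = m}"
    unfolding nth_largest_def using assms finite_choices choices_nonempty[of m p]
    by (intro Min_in) auto
  then obtain J where J: "J \<subseteq> {..<p}" "card J = m" "nth_largest p m x = Max (x ` ({..<p} - J))"
    by auto
  show thesis
    using J choice_compl_nonempty[of m p J] assms
    by (intro that[of J]) (auto intro!: Max_ge Max_in)
qed

text \<open>A choice \<open>J\<close> optimal for \<open>y\<close> serves for \<open>x\<close> at
  cost \<open>e\<close>. Used in both directions this gives continuity.\<close>

lemma nth_largest_perturb:
  assumes "m < p" "\<And>i. i < p \<Longrightarrow> x i \<le> y i + e"
  shows "nth_largest p m x \<le> nth_largest p m y + e"
proof -
  obtain J where J: "J \<subseteq> {..<p}" "card J = m" "\<And>i. i < p \<Longrightarrow> i \<notin> J \<Longrightarrow> y i \<le> nth_largest p m y"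
    using nth_largest_attained[OF assms(1)] by metis
  show ?thesis
    by (rule nth_largest_le[OF assms(1) J(1,2)]) (use J(3) assms(2) in force)
qed

lemma le_nth_largest_0:
  assumes "i < p"
  shows "x i \<le> nth_largest p 0 x"
proof -
  have "0 < p" using assms by simp
  then show ?thesis
  proof (rule nth_largest_attained[of 0 p x])
    fix J
    assume "J \<subseteq> {..<p}" "card J = 0" "\<And>i. i < p \<Longrightarrow> i \<notin> J \<Longrightarrow> x i \<le> nth_largest p 0 x"
    then show ?thesis using assms by (auto dest: finite_subset)
  qed
qed

text \<open>Discarding all maximal coordinates, padded to \<open>m\<close> indices, leaves only
  smaller ones.\<close>

lemma nth_largest_less_top:
  assumes "m < p" "card {i. i < p \<and> x i = nth_largest p 0 x} \<le> m"
  shows "nth_largest p m x < nth_largest p 0 x"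
proof -
  obtain J where J: "{i. i < p \<and> x i = nth_largest p 0 x} \<subseteq> J" "J \<subseteq> {..<p}" "card J = m"
    using exists_subset_between[of "{i. i < p \<and> x i = nth_largest p 0 x}" m "{..<p}"] assms
    by (metis (no_types, lifting) card_lessThan finite_lessThan lessThan_iff less_imp_le
        mem_Collect_eq subsetI)
  have less: "x i < nth_largest p 0 x" if "i < p" "i \<notin> J" for i
    using that J(1) le_nth_largest_0[of i p x] by force
  have "Max (x ` ({..<p} - J)) < nth_largest p 0 x"
    using less choice_compl_nonempty[OF assms(1) J(2,3)] by (subst Max_less_iff) auto
  moreover have "nth_largest p m x \<le> Max (x ` ({..<p} - J))"
    by (rule nth_largest_le[OF assms(1) J(2,3)]) auto
  ultimately show ?thesis by linarith
qed

lemma continuous_on_nth_largest: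
  assumes "m < p" "\<And>i. i < p \<Longrightarrow> continuous_on X (\<lambda>y. E y i)"
  shows "continuous_on X (\<lambda>y. nth_largest p m (E y))"
proof (unfold continuous_on, intro ballI tendstoI)
  fix y0 and e :: real
  assume y0: "y0 \<in> X" and e: "0 < e"
  have "\<forall>\<^sub>F y in at y0 within X. dist (E y i) (E y0 i) < e / 2" if "i < p" for i
    using assms(2)[OF that] y0 e by (metis continuous_on tendstoD half_gt_zero)
  then have "\<forall>\<^sub>F y in at y0 within X. \<forall>i\<in>{..<p}. dist (E y i) (E y0 i) < e / 2"
    by (intro eventually_ball_finite) auto
  then show "\<forall>\<^sub>F y in at y0 within X. dist (nth_largest p m (E y)) (nth_largest p m (E y0)) < e"
  proof (rule eventually_mono)
    fix y
    assume *: "\<forall>i\<in>{..<p}. dist (E y i) (E y0 i) < e / 2"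
    have **: "E y i \<le> E y0 i + e / 2" "E y0 i \<le> E y i + e / 2" if "i < p" for i
    proof -
      have "\<bar>E y i - E y0 i\<bar> < e / 2" using * that by (simp add: dist_real_def)
      then show "E y i \<le> E y0 i + e / 2" "E y0 i \<le> E y i + e / 2" by linarith+
    qed
    show "dist (nth_largest p m (E y)) (nth_largest p m (E y0)) < e"
      using nth_largest_perturb[OF assms(1), of "E y" "E y0" "e / 2", OF **(1)]
        nth_largest_perturb[OF assms(1), of "E y0" "E y" "e / 2", OF **(2)] e
      unfolding dist_real_def by linarith
  qed
qed

section \<open>The retraction onto the skeleton\<close>

definition skeleton :: "nat \<Rightarrow> nat \<Rightarrow> nat set set" where
  "skeleton p n = {s. s \<subseteq> {..<p} \<and> s \<noteq> {} \<and> card s \<le> n + 1}"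

text \<open>
  Subtracting the \<open>(n + 2)\<close>-nd largest coordinate and truncating at \<open>0\<close> leaves at most \<open>n + 1\<close>
  positive coordinates. This retracts the points whose \<open>n + 2\<close> largest coordinates are not all
  equal onto the \<open>n\<close>-skeleton.
\<close>

definition truncation :: "nat \<Rightarrow> nat \<Rightarrow> (nat \<Rightarrow> real) \<Rightarrow> nat \<Rightarrow> real" where
  "truncation p m x = (\<lambda>i. if i < p then max 0 (x i - nth_largest p m x) else 0)"

definition retract_skeleton :: "nat \<Rightarrow> nat \<Rightarrow> (nat \<Rightarrow> real) \<Rightarrow> nat \<Rightarrow> real" where
  "retract_skeleton p n x =
     (\<lambda>i. truncation p (n + 1) x i / (\<Sum>j<p. truncation p (n + 1) x j))"

lemma truncation_sum_pos:
  assumes "m < p" "nth_largest p m x < nth_largest p 0 x"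
  shows "0 < (\<Sum>j<p. truncation p m x j)"
proof -
  have "0 < p" using assms(1) by simp
  then obtain i where "i < p" "nth_largest p 0 x = x i"
    by (rule nth_largest_attained[of 0 p x]) auto
  then show ?thesis
    using assms by (intro sum_pos2[of _ i]) (auto simp: truncation_def)
qed

lemma sum_support:
  assumes "support x \<subseteq> {..<p}"
  shows "(\<Sum>v\<in>support x. x v) = (\<Sum>v<p. x v)"
  by (rule sum.mono_neutral_left) (use assms in \<open>auto simp: support_def\<close>)

lemma retract_skeleton_in:
  assumes "n + 1 < p" "nth_largest p (n + 1) x < nth_largest p 0 x"
  shows "retract_skeleton p n x \<in> realization (skeleton p n)"
proof -
  let ?r = "retract_skeleton p n x"
  let ?S = "\<Sum>j<p. truncation p (n + 1) x j"
  have S: "0 < ?S" using truncation_sum_pos assms by blast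
  \<comment> \<open>Coordinates outside \<open>J\<close> do not exceed the subtracted one and become
    0, so the support lies in a set of \<open>n + 1\<close> vertices.\<close>
  obtain J where J: "J \<subseteq> {..<p}" "card J = n + 1"
    "\<And>i. i < p \<Longrightarrow> i \<notin> J \<Longrightarrow> x i \<le> nth_largest p (n + 1) x"
    using nth_largest_attained[OF assms(1)] by metis
  have supp: "support ?r \<subseteq> J"
    using J(3) by (force simp: support_def retract_skeleton_def truncation_def split: if_splits)
  have "(\<Sum>v\<in>support ?r. ?r v) = (\<Sum>v<p. ?r v)"
    using supp J by (intro sum_support) auto
  also have "\<dots> = 1"
    unfolding retract_skeleton_def sum_divide_distrib[symmetric] using S by simp
  finally have 1: "(\<Sum>v\<in>support ?r. ?r v) = 1" .
  then have "support ?r \<noteq> {}" by auto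
  moreover have "card (support ?r) \<le> n + 1"
    using card_mono[OF finite_subset[OF J(1)] supp] J(2) by simp
  moreover have "0 \<le> ?r v" for v
    using S by (auto simp: retract_skeleton_def truncation_def)
  ultimately show ?thesis using 1 supp J by (auto simp: realization_def skeleton_def)
qed

lemma realization_skeletonD:
  assumes "x \<in> realization (skeleton p n)"
  shows "0 \<le> x v" "support x \<subseteq> {..<p}" "card (support x) \<le> n + 1" "(\<Sum>v<p. x v) = 1"
    "p \<le> v \<Longrightarrow> x v = 0"
proof -
  have x: "\<And>v. 0 \<le> x v" "support x \<in> skeleton p n" "(\<Sum>v\<in>support x. x v) = 1"
    using assms unfolding realization_def by blast+
  show "0 \<le> x v" by (rule x)
  show supp: "support x \<subseteq> {..<p}" and "card (support x) \<le> n + 1"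
    using x(2) by (auto simp: skeleton_def)
  show "(\<Sum>v<p. x v) = 1" using x(3) unfolding sum_support[OF supp] .
  show "x v = 0" if "p \<le> v" using supp that by (auto simp: support_def)
qed

text \<open>At most \<open>n + 1\<close> coordinates are nonzero, and the largest is at least the
  mean of all \<open>p\<close>. On the skeleton the gap between the two order statistics is thus at
  least \<open>1 / p\<close>, uniformly in \<open>x\<close>.\<close>

lemma nth_largest_skeleton:
  assumes "n + 1 < p" "x \<in> realization (skeleton p n)"
  shows "nth_largest p (n + 1) x = 0" "1 / real p \<le> nth_largest p 0 x"
proof -
  note x = realization_skeletonD[OF assms(2)]
  obtain J where J: "support x \<subseteq> J" "J \<subseteq> {..<p}" "card J = n + 1"
    using exists_subset_between[OF x(3) _ x(2) finite_lessThan] assms(1) by auto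
  have "nth_largest p (n + 1) x \<le> 0"
    by (rule nth_largest_le[OF assms(1) J(2,3)]) (use J(1) in \<open>force simp: support_def\<close>)
  moreover have "0 \<le> nth_largest p (n + 1) x"
    by (rule nth_largest_attained[OF assms(1), of x]) (use x(1) in auto)
  ultimately show "nth_largest p (n + 1) x = 0" by simp
  have "(\<Sum>v<p. x v) \<le> (\<Sum>v<p. nth_largest p 0 x)"
    by (rule sum_mono) (simp add: le_nth_largest_0)
  then show "1 / real p \<le> nth_largest p 0 x"
    using x(4) assms(1) by (simp add: field_simps)
qed

lemma retract_skeleton_id:
  assumes "n + 1 < p" "x \<in> realization (skeleton p n)"
  shows "retract_skeleton p n x = x"
proof -
  note x = realization_skeletonD[OF assms(2)]
  have t: "truncation p (n + 1) x = x"
  proof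
    show "truncation p (n + 1) x i = x i" for i
      using x(1)[of i] x(5)[of i] nth_largest_skeleton(1)[OF assms]
      by (cases "i < p") (simp_all add: truncation_def)
  qed
  show ?thesis unfolding retract_skeleton_def t x(4) by simp
qed

lemma continuous_on_retract_skeleton:
  assumes "n + 1 < p" "\<And>i. i < p \<Longrightarrow> continuous_on X (\<lambda>y. E y i)"
    "\<And>y. y \<in> X \<Longrightarrow> nth_largest p (n + 1) (E y) < nth_largest p 0 (E y)"
  shows "continuous_on X (\<lambda>y. retract_skeleton p n (E y))"
proof (rule continuous_on_coordinatewise_then_product)
  fix i
  have t: "continuous_on X (\<lambda>y. truncation p (n + 1) (E y) i)" for i
  proof (cases "i < p")
    case True
    then show ?thesis
      unfolding truncation_def using assms
      by (simp only: if_True) (intro continuous_intros continuous_on_nth_largest)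
  qed (simp add: truncation_def)
  have "(\<Sum>j<p. truncation p (n + 1) (E y) j) \<noteq> 0" if "y \<in> X" for y
    using truncation_sum_pos[OF assms(1) assms(3)[OF that]] by simp
  then show "continuous_on X (\<lambda>y. retract_skeleton p n (E y) i)"
    unfolding retract_skeleton_def by (intro continuous_intros t) auto
qed

section \<open>Extension of maps into the skeleton and vanishing of homotopy groups\<close>

text \<open>The perturbation must vanish on \<open>S\<close>, so a cutoff \<open>\<Lambda>\<close>
  depending on the gap of the unperturbed \<open>F\<close> blends \<open>F\<close> with
  \<open>G\<close>. Where that gap is large, a small perturbation leaves it positive; where it is
  small, \<open>G\<close> takes over.\<close>

lemma skeleton_extension:
  assumes n: "d \<le> n" "n + 1 < p"
    and S: "closed S" "S \<subseteq> cube d"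
    and f: "continuous_on S f" "f ` S \<subseteq> realization (skeleton p n)"
  obtains H where "continuous_on (cube d) H" "H ` cube d \<subseteq> realization (skeleton p n)"
    "\<And>x. x \<in> S \<Longrightarrow> H x = f x"
proof -
  \<comment> \<open>Tietze's theorem is applied to each coordinate; the extension need not take
    values in the complex.\<close>
  have "\<forall>i. \<exists>g. continuous_on UNIV g \<and> (\<forall>x\<in>S. g x = f x i)"
  proof
    fix i
    have "continuous_on S (\<lambda>x. f x i)" using f(1) by (rule continuous_on_product_then_coordinatewise)
    moreover have "closedin (top_of_set UNIV) S" using S(1) by simp
    ultimately show "\<exists>g. continuous_on UNIV g \<and> (\<forall>x\<in>S. g x = f x i)"
      by (rule Tietze_unbounded) blast
  qed
  from choice[OF this] obtain F
    where F: "\<And>i. continuous_on UNIV (F i)" "\<And>i x. x \<in> S \<Longrightarrow> F i x = f x i"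
    by blast
  have Fc: "continuous_on (cube d) (F i)" for i using F(1) continuous_on_subset by blast
  define gap where "gap x = nth_largest p 0 x - nth_largest p (n + 1) x" for x
  \<comment> \<open>On \<open>S\<close> the gap is at least \<open>1 / p = 2 * \<beta>\<close>, so
    \<open>\<Lambda>\<close> is 1 there; it is 0 where the gap is at most
    \<open>\<beta>\<close>.\<close>
  define \<beta> where "\<beta> = 1 / (2 * real p)"
  have \<beta>: "0 < \<beta>" using n by (simp add: \<beta>_def)
  have "0 < \<beta> / 4" using \<beta> by simp
  then obtain G where G: "\<And>i. i < p \<Longrightarrow> continuous_on (cube d) (G i)"
    "\<And>i y. i < p \<Longrightarrow> y \<in> cube d \<Longrightarrow> \<bar>G i y - F i y\<bar> < \<beta> / 4"
    "\<And>y a. y \<in> cube d \<Longrightarrow> card {i. i < p \<and> G i y = a} \<le> d + 1"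
    by (rule few_coincidences[where F = F and p = p, OF Fc]) (rule that)
  define \<Lambda> where "\<Lambda> y = clamp01 ((gap (\<lambda>i. F i y) - \<beta>) / \<beta>)" for y
  define E where "E y i = G i y + \<Lambda> y * (F i y - G i y)" for y i
  have \<Lambda>01: "0 \<le> \<Lambda> y" "\<Lambda> y \<le> 1" for y by (auto simp: \<Lambda>_def clamp01_def)
  have \<Lambda>c: "continuous_on (cube d) \<Lambda>"
    unfolding \<Lambda>_def clamp01_def gap_def
    by (intro continuous_intros continuous_on_nth_largest Fc) (use n \<beta> in auto)
  have Ec: "continuous_on (cube d) (\<lambda>y. E y i)" if "i < p" for i
    unfolding E_def using that by (intro continuous_intros \<Lambda>c Fc G(1))
  have E_gap: "nth_largest p (n + 1) (E y) < nth_largest p 0 (E y)" if y: "y \<in> cube d" for y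
  proof (cases "gap (\<lambda>i. F i y) \<le> \<beta>")
    case True
    then have "\<Lambda> y = 0" using \<beta> by (simp add: \<Lambda>_def clamp01_def divide_nonpos_pos)
    \<comment> \<open>Here \<open>E\<close> agrees with \<open>G\<close>, so at most
      \<open>d + 1 \<le> n + 1\<close> coordinates attain the maximum.\<close>
    then show ?thesis
      using G(3)[OF y, of "nth_largest p 0 (E y)"] n by (intro nth_largest_less_top) (auto simp: E_def)
  next
    case False
    have near: "\<bar>E y i - F i y\<bar> \<le> \<beta> / 4" if "i < p" for i
    proof -
      have "E y i - F i y = (1 - \<Lambda> y) * (G i y - F i y)" by (simp add: E_def algebra_simps)
      then have "\<bar>E y i - F i y\<bar> = \<bar>1 - \<Lambda> y\<bar> * \<bar>G i y - F i y\<bar>" by (simp only: abs_mult)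
      also have "\<dots> \<le> \<bar>G i y - F i y\<bar>"
        using \<Lambda>01[of y] by (intro mult_left_le_one_le) auto
      also have "\<dots> < \<beta> / 4" by (rule G(2)[OF that y])
      finally show ?thesis by simp
    qed
    have near1: "E y i \<le> F i y + \<beta> / 4" and near2: "F i y \<le> E y i + \<beta> / 4" if "i < p" for i
      using near[OF that] unfolding abs_le_iff by linarith+
    \<comment> \<open>The gap shrinks by at most \<open>\<beta> / 2\<close>, and it was above
      \<open>\<beta>\<close>.\<close>
    have "nth_largest p (n + 1) (E y) \<le> nth_largest p (n + 1) (\<lambda>i. F i y) + \<beta> / 4"
      by (rule nth_largest_perturb) (use n near1 in auto)
    moreover have "nth_largest p 0 (\<lambda>i. F i y) \<le> nth_largest p 0 (E y) + \<beta> / 4"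
      by (rule nth_largest_perturb) (use n near2 in auto)
    ultimately show ?thesis using False \<beta> by (simp add: gap_def)
  qed
  show thesis
  proof
    show "continuous_on (cube d) (\<lambda>y. retract_skeleton p n (E y))"
      by (rule continuous_on_retract_skeleton[OF n(2) Ec E_gap])
    show "(\<lambda>y. retract_skeleton p n (E y)) ` cube d \<subseteq> realization (skeleton p n)"
      using retract_skeleton_in[OF n(2) E_gap] by auto
    fix x assume x: "x \<in> S"
    have fx: "f x \<in> realization (skeleton p n)" using f(2) x by auto
    have Fx: "(\<lambda>i. F i x) = f x" using F(2)[OF x] by auto
    have "2 * \<beta> \<le> gap (f x)"
      using nth_largest_skeleton[OF n(2) fx] by (simp add: gap_def \<beta>_def)
    then have "\<Lambda> x = 1" using \<beta> by (simp add: \<Lambda>_def clamp01_def Fx field_simps)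
    then have "E x = f x" using F(2)[OF x] by (auto simp: E_def)
    then show "retract_skeleton p n (E x) = f x"
      using retract_skeleton_id[OF n(2) fx] by simp
  qed
qed

lemma nsphere_as_subset:
  "nsphere k = top_of_set {x. (\<Sum>i\<le>k. x i ^ 2) = 1 \<and> (\<forall>i>k. x i = 0)}"
  by (auto simp: nsphere Euclidean_space_def euclidean_product_topology subtopology_subtopology
      intro!: arg_cong[where f = "subtopology _"])

text \<open>The map extends from the sphere to the cube of dimension \<open>k + 1 \<le> n\<close>.
  Contracting the sphere along straight lines to its base point inside this convex cube and applying
  the extension gives the null-homotopy.\<close>

lemma trivial_homotopy_skeleton:
  assumes "k < n" "n + 1 < p"
  shows "trivial_homotopy k (realization_space (skeleton p n))"
  unfolding trivial_homotopy_def
proof (intro ballI allI impI, elim conjE)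
  fix x0 f
  let ?X = "realization (skeleton p n)"
  define S where "S = {x :: nat \<Rightarrow> real. (\<Sum>i\<le>k. x i ^ 2) = 1 \<and> (\<forall>i>k. x i = 0)}"
  have sph: "nsphere k = top_of_set S" unfolding S_def by (rule nsphere_as_subset)
  assume "x0 \<in> topspace (realization_space (skeleton p n))"
    and f: "continuous_map (nsphere k) (realization_space (skeleton p n)) f"
    and f0: "f sphere_base = x0"
  have "sphere_base i ^ 2 = (if i = 0 then 1 else 0)" for i by (simp add: sphere_base_def)
  then have base: "sphere_base \<in> S" by (simp add: S_def) (simp add: sphere_base_def)
  have f: "continuous_on S f" "f ` S \<subseteq> ?X"
    using f unfolding sph by (auto simp: image_subset_iff)
  have "S = (\<Inter>i\<in>{k<..}. {x. x i = 0}) \<inter> {x. (\<Sum>i\<le>k. x i ^ 2) = 1}"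
    by (auto simp: S_def)
  moreover have "closed \<dots>"
    by (intro closed_Int closed_INT ballI closed_Collect_eq continuous_intros
        continuous_on_product_coordinates)
  ultimately have closed: "closed S" by simp
  have sub: "S \<subseteq> cube (Suc k)"
  proof
    fix x assume x: "x \<in> S"
    have "x i ^ 2 \<le> 1" if "i \<le> k" for i
      using member_le_sum[of i "{..k}" "\<lambda>i. x i ^ 2"] that x by (simp add: S_def)
    then show "x \<in> cube (Suc k)"
      using x by (auto simp: cube_def S_def abs_square_le_1 abs_le_iff less_Suc_eq_le)
  qed
  obtain H where H: "continuous_on (cube (Suc k)) H" "H ` cube (Suc k) \<subseteq> ?X"
    "\<And>x. x \<in> S \<Longrightarrow> H x = f x"
    using skeleton_extension[OF _ assms(2) closed sub f] assms(1) by (metis Suc_leI)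
  define c where "c = (\<lambda>(t, x) i. (1 - t) * x i + t * sphere_base i)"
  have c_in: "c (t, x) \<in> cube (Suc k)" if "t \<in> {0..1}" "x \<in> S" for t x
  proof -
    have x: "x \<in> cube (Suc k)" and b: "sphere_base \<in> cube (Suc k)" using that sub base by auto
    have "(1 - t) * x i + t * sphere_base i \<in> {-1..1}" if "i < Suc k" for i
      using convexD_alt[of "{-1..1::real}" "x i" "sphere_base i" t] x b that \<open>t \<in> {0..1}\<close>
      by (auto simp: cube_def)
    then show ?thesis using x b by (auto simp: c_def cube_def)
  qed
  have c_cont: "continuous_on ({0..1} \<times> S) c"
  proof (rule continuous_on_coordinatewise_then_product)
    fix i
    have "continuous_on ({0..1} \<times> S) (\<lambda>z. snd z i)"
      by (rule continuous_on_product_then_coordinatewise) (rule continuous_on_snd[OF continuous_on_id])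
    then show "continuous_on ({0..1} \<times> S) (\<lambda>z. c z i)"
      unfolding c_def case_prod_beta by (intro continuous_intros)
  qed
  have Hc: "continuous_map (prod_topology (top_of_set {0..1}) (nsphere k))
      (realization_space (skeleton p n)) (H \<circ> c)"
  proof -
    have "continuous_on ({0..1} \<times> S) (H \<circ> c)"
      by (intro continuous_on_compose c_cont continuous_on_subset[OF H(1)]) (use c_in in auto)
    moreover have "(H \<circ> c) ` ({0..1} \<times> S) \<subseteq> ?X" using c_in H(2) by auto
    ultimately show ?thesis
      unfolding sph prod_topology_subtopology_eu
      by (simp add: continuous_map_subtopology_eu image_subset_iff_funcset comp_def)
  qed
  \<comment> \<open>The contraction fixes the base point at all times, so the homotopy is
    pointed.\<close>
  have cb: "c (t, sphere_base) = sphere_base" for t by (auto simp: c_def algebra_simps)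
  have ends: "c (0, x) = x" "c (1, x) = sphere_base" for x by (auto simp: c_def)
  have "sphere_base \<in> topspace (nsphere k)" using base sph by simp
  then show "homotopic_with (\<lambda>h. h sphere_base = x0) (nsphere k)
      (realization_space (skeleton p n)) f (\<lambda>_. x0)"
    by (subst homotopic_with)
      (use Hc H(3) base f0 sph cb ends in \<open>auto intro!: exI[of _ "H \<circ> c"]\<close>)
qed

section \<open>The cyclic action on the skeleton\<close>

text \<open>Vertex \<open>v\<close> is carried to \<open>v - 1\<close>, and vertex 0 to
  \<open>p - 1\<close>. Coordinates from \<open>p\<close> on stay fixed, so the \<open>p\<close>-th
  power is the identity on all functions.\<close>

definition cyclic_shift :: "nat \<Rightarrow> (nat \<Rightarrow> real) \<Rightarrow> nat \<Rightarrow> real" where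
  "cyclic_shift p x = (\<lambda>v. if v < p then x ((v + 1) mod p) else x v)"

lemma funpow_cyclic_shift:
  "(cyclic_shift p ^^ k) x = (\<lambda>v. if v < p then x ((v + k) mod p) else x v)"
proof (induction k)
  case (Suc k)
  show ?case
  proof
    fix v
    show "(cyclic_shift p ^^ Suc k) x v = (if v < p then x ((v + Suc k) mod p) else x v)"
      by (simp add: Suc cyclic_shift_def mod_add_left_eq)
  qed
qed auto

lemma cyclic_shift_period: "(cyclic_shift p ^^ p) x = x"
  by (auto simp: funpow_cyclic_shift)

lemma continuous_on_funpow_cyclic_shift: "continuous_on X (cyclic_shift p ^^ k)"
proof (rule continuous_on_coordinatewise_then_product)
  show "continuous_on X (\<lambda>x. (cyclic_shift p ^^ k) x v)" for v
    unfolding funpow_cyclic_shift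
    by (cases "v < p") (auto intro: continuous_on_subset[OF continuous_on_product_coordinates])
qed

lemma realization_skeletonI:
  assumes "\<And>v. 0 \<le> x v" "support x \<subseteq> {..<p}" "card (support x) \<le> n + 1" "(\<Sum>v<p. x v) = 1"
  shows "x \<in> realization (skeleton p n)"
proof -
  have "(\<Sum>v\<in>support x. x v) = 1" using assms(4) unfolding sum_support[OF assms(2)] .
  moreover from this have "support x \<noteq> {}" by auto
  ultimately show ?thesis using assms by (simp add: realization_def skeleton_def)
qed

lemma bij_betw_rotation: "bij_betw (\<lambda>v. (v + k) mod p) {..<p} {..<p::nat}"
proof (cases "p = 0")
  case False
  have "(\<lambda>v. (v + k) mod p) ` {..<p} \<subseteq> {..<p}" using False by auto
  moreover have "inj_on (\<lambda>v. (v + k) mod p) {..<p}"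
  proof (rule inj_onI)
    fix u v assume "u \<in> {..<p}" "v \<in> {..<p}" and e: "(u + k) mod p = (v + k) mod p"
    \<comment> \<open>Adding \<open>p * k - k\<close> completes \<open>k\<close> to a multiple of
      \<open>p\<close> and so undoes the rotation.\<close>
    have "(u + k + (p * k - k)) mod p = (v + k + (p * k - k)) mod p"
      by (rule mod_add_cong[OF e refl])
    moreover have "w + k + (p * k - k) = w + p * k" for w using False by simp
    ultimately show "u = v" using \<open>u \<in> {..<p}\<close> \<open>v \<in> {..<p}\<close> by simp
  qed
  ultimately show ?thesis
    using endo_inj_surj[OF finite_lessThan] unfolding bij_betw_def by blast
qed (simp add: bij_betw_def)

lemma support_cyclic_shift:
  assumes "support x \<subseteq> {..<p}"
  shows "support (cyclic_shift p x) = {v \<in> {..<p}. (v + 1) mod p \<in> support x}"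
  using assms by (auto simp: support_def cyclic_shift_def)

lemma card_rotated_le:
  assumes "finite A"
  shows "card {v \<in> {..<p::nat}. (v + 1) mod p \<in> A} \<le> card A"
proof (rule card_inj_on_le)
  show "inj_on (\<lambda>v. (v + 1) mod p) {v \<in> {..<p}. (v + 1) mod p \<in> A}"
    using bij_betw_rotation[of 1 p] by (auto simp: bij_betw_def intro: inj_on_subset)
qed (use assms in auto)

lemma cyclic_shift_in:
  assumes "x \<in> realization (skeleton p n)"
  shows "cyclic_shift p x \<in> realization (skeleton p n)"
proof -
  note x = realization_skeletonD[OF assms]
  have fin: "finite (support x)" using x(2) by (rule finite_subset) simp
  show ?thesis
  proof (rule realization_skeletonI)
    show "0 \<le> cyclic_shift p x v" for v by (simp add: cyclic_shift_def x(1))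
    show "support (cyclic_shift p x) \<subseteq> {..<p}" using support_cyclic_shift[OF x(2)] by auto
    show "card (support (cyclic_shift p x)) \<le> n + 1"
      using card_rotated_le[OF fin, of p] x(3) unfolding support_cyclic_shift[OF x(2)] by linarith
    have "(\<Sum>v<p. cyclic_shift p x v) = (\<Sum>v<p. x ((v + 1) mod p))"
      by (rule sum.cong) (auto simp: cyclic_shift_def)
    also have "\<dots> = (\<Sum>v<p. x v)" by (rule sum.reindex_bij_betw[OF bij_betw_rotation])
    finally show "(\<Sum>v<p. cyclic_shift p x v) = 1" using x(4) by simp
  qed
qed

lemma funpow_cyclic_shift_in:
  assumes "x \<in> realization (skeleton p n)"
  shows "(cyclic_shift p ^^ k) x \<in> realization (skeleton p n)"
  using assms by (induction k) (auto intro: cyclic_shift_in)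

lemma cyclic_shift_pred:
  assumes "0 < p"
  shows "cyclic_shift p ((cyclic_shift p ^^ (p - 1)) x) = x"
    "(cyclic_shift p ^^ (p - 1)) (cyclic_shift p x) = x"
proof -
  have "Suc (p - 1) = p" using assms by simp
  then show "cyclic_shift p ((cyclic_shift p ^^ (p - 1)) x) = x"
    "(cyclic_shift p ^^ (p - 1)) (cyclic_shift p x) = x"
    using cyclic_shift_period[of p x] by (metis comp_apply funpow.simps(2), metis comp_apply funpow_Suc_right)
qed

text \<open>A fixed point has \<open>p\<close> equal, hence nonzero, coordinates, but supports have
  at most \<open>n + 1 < p\<close> elements.\<close>

lemma free_Zp_space_skeleton:
  assumes "n + 1 < p"
  shows "free_Zp_space p (realization_space (skeleton p n)) (cyclic_shift p)"
proof -
  let ?X = "realization (skeleton p n)"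
  have "homeomorphic_maps (top_of_set ?X) (top_of_set ?X) (cyclic_shift p) (cyclic_shift p ^^ (p - 1))"
    unfolding homeomorphic_maps_def
    using continuous_on_funpow_cyclic_shift[of ?X 1 p] continuous_on_funpow_cyclic_shift[of ?X "p - 1" p]
      cyclic_shift_pred[of p] cyclic_shift_in funpow_cyclic_shift_in assms
    by auto
  then have "homeomorphic_map (top_of_set ?X) (top_of_set ?X) (cyclic_shift p)"
    by (rule homeomorphic_maps_imp_map)
  moreover have "cyclic_shift p x \<noteq> x" if "x \<in> ?X" for x
  proof
    assume fixed: "cyclic_shift p x = x"
    note x = realization_skeletonD[OF that]
    have const: "x v = x 0" if "v < p" for v
    proof -
      have "(cyclic_shift p ^^ v) x = x" using fixed by (induction v) auto
      then have "x 0 = (cyclic_shift p ^^ v) x 0" by simp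
      also have "\<dots> = x v" using that by (simp add: funpow_cyclic_shift)
      finally show ?thesis by simp
    qed
    have "x 0 \<noteq> 0"
    proof
      assume "x 0 = 0"
      then have "(\<Sum>v<p. x v) = 0" using const by (intro sum.neutral) auto
      then show False using x(4) by simp
    qed
    then have "x v \<noteq> 0" if "v < p" for v using const[OF that] by simp
    then have "{..<p} \<subseteq> support x" by (auto simp: support_def)
    then have "p \<le> card (support x)"
      using card_mono[OF finite_subset[OF x(2)], of "{..<p}"] by simp
    then show False using x(3) assms by simp
  qed
  ultimately show ?thesis
    by (simp add: free_Zp_space_def Zp_space_def cyclic_shift_period)
qed

lemma simplicial_self_map_cyclic_shift:
  assumes "0 < p"
  shows "simplicial_self_map (skeleton p n) (cyclic_shift p)"
  unfolding simplicial_self_map_def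
proof (intro ballI conjI)
  fix s assume "s \<in> skeleton p n"
  then have s: "s \<subseteq> {..<p}" "s \<noteq> {}" "card s \<le> n + 1" by (auto simp: skeleton_def)
  define s' where "s' = {v \<in> {..<p}. (v + 1) mod p \<in> s}"
  have fin: "finite s" using s(1) by (rule finite_subset) simp
  obtain u where u: "u \<in> s" using s(2) by blast
  then obtain v where "v < p" "(v + 1) mod p = u"
    using bij_betw_rotation[of 1 p] s(1) by (metis (no_types, lifting) bij_betw_def imageE lessThan_iff subsetD)
  then have "s' \<noteq> {}" using u by (auto simp: s'_def)
  then have "s' \<in> skeleton p n"
    using card_rotated_le[OF fin, of p] s(3) by (auto simp: skeleton_def s'_def)
  moreover have "cyclic_shift p ` closed_simplex (skeleton p n) s = closed_simplex (skeleton p n) s'"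
  proof (intro equalityI subsetI)
    fix y assume "y \<in> cyclic_shift p ` closed_simplex (skeleton p n) s"
    then obtain x where x: "y = cyclic_shift p x" "x \<in> realization (skeleton p n)" "support x \<subseteq> s"
      by (auto simp: closed_simplex_def)
    then show "y \<in> closed_simplex (skeleton p n) s'"
      using cyclic_shift_in support_cyclic_shift[OF realization_skeletonD(2)[OF x(2)]]
      by (auto simp: closed_simplex_def s'_def)
  next
    fix y assume "y \<in> closed_simplex (skeleton p n) s'"
    then have y: "y \<in> realization (skeleton p n)" "support y \<subseteq> s'" by (auto simp: closed_simplex_def)
    \<comment> \<open>The inverse of the shift is its power \<open>p - 1\<close>.\<close>
    define x where "x = (cyclic_shift p ^^ (p - 1)) y"
    have x: "x \<in> realization (skeleton p n)" unfolding x_def by (rule funpow_cyclic_shift_in[OF y(1)])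
    have "v \<in> s" if "v \<in> support x" for v
    proof -
      have "v < p" using realization_skeletonD(2)[OF x] that by auto
      moreover have "(v + (p - 1)) mod p \<in> s'"
        using that \<open>v < p\<close> y(2) by (auto simp: x_def funpow_cyclic_shift support_def)
      ultimately show ?thesis by (simp add: s'_def mod_Suc_eq)
    qed
    then have "x \<in> closed_simplex (skeleton p n) s" using x by (auto simp: closed_simplex_def)
    moreover have "y = cyclic_shift p x" unfolding x_def using cyclic_shift_pred(1)[OF assms] by simp
    ultimately show "y \<in> cyclic_shift p ` closed_simplex (skeleton p n) s" by blast
  qed
  ultimately show "\<exists>s'\<in>skeleton p n.
      cyclic_shift p ` closed_simplex (skeleton p n) s = closed_simplex (skeleton p n) s'"
    by blast
qed (auto simp: cyclic_shift_def)

theorem E_space_skeleton: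
  assumes "n + 1 < p"
  shows "E_space p n (skeleton p n) (cyclic_shift p)"
proof -
  have "finite_complex (skeleton p n)"
  proof -
    have "finite (skeleton p n)"
      by (rule finite_subset[of _ "Pow {..<p}"]) (auto simp: skeleton_def)
    moreover have "finite s" "s \<noteq> {}" if "s \<in> skeleton p n" for s
      using that by (auto simp: skeleton_def intro: finite_subset)
    moreover have "t \<in> skeleton p n" if "s \<in> skeleton p n" "t \<noteq> {}" "t \<subseteq> s" for s t
    proof -
      have s: "s \<subseteq> {..<p}" "card s \<le> n + 1" using that by (auto simp: skeleton_def)
      then have "card t \<le> card s" using that(3) by (meson card_mono finite_lessThan finite_subset)
      then show ?thesis using s that by (auto simp: skeleton_def)
    qed
    ultimately show ?thesis unfolding finite_complex_def by blast
  qed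
  moreover have "has_dim (skeleton p n) n"
    unfolding has_dim_def
  proof
    have "{..n} \<in> skeleton p n" using assms by (auto simp: skeleton_def)
    then show "\<exists>s\<in>skeleton p n. card s = n + 1" by (rule rev_bexI) simp
  qed (simp add: skeleton_def)
  moreover have "simplicial_self_map (skeleton p n) (cyclic_shift p)"
    using assms by (intro simplicial_self_map_cyclic_shift) simp
  moreover have "\<forall>k<n. trivial_homotopy k (realization_space (skeleton p n))"
    using trivial_homotopy_skeleton[OF _ assms] by blast
  ultimately show ?thesis
    using free_Zp_space_skeleton[OF assms] unfolding E_space_def by blast
qed

section \<open>A cocycle with small orbit mean\<close>

definition phase :: "nat \<Rightarrow> (nat \<Rightarrow> real) \<Rightarrow> complex" where
  "phase p x = cis (pi * (\<Sum>v<p. real v * x v))"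

text \<open>With vertex 0 outside the support nothing wraps around: every index in the support drops
  by one, so the weighted sum drops by the total mass 1 and the angle by \<open>pi\<close>.\<close>

lemma phase_cyclic_shift:
  assumes "x \<in> realization (skeleton p n)" "x 0 = 0" "0 < p"
  shows "phase p (cyclic_shift p x) = - phase p x"
proof -
  obtain q where q: "p = Suc q" using assms(3) by (cases p) auto
  have 1: "(\<Sum>v<q. x (Suc v)) = 1"
    using realization_skeletonD(4)[OF assms(1)] assms(2)
    unfolding q sum.lessThan_Suc_shift by simp
  have "(\<Sum>v<p. real v * cyclic_shift p x v) = (\<Sum>v<q. real v * x (Suc v))"
    by (simp add: q cyclic_shift_def assms(2))
  moreover have "(\<Sum>v<p. real v * x v) = (\<Sum>v<q. real (Suc v) * x (Suc v))"
    unfolding q sum.lessThan_Suc_shift by simp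
  then have "(\<Sum>v<p. real v * x v) = (\<Sum>v<q. real v * x (Suc v)) + 1"
    using 1 by (simp add: algebra_simps sum.distrib)
  ultimately show ?thesis
    by (simp add: phase_def distrib_left cis_mult[symmetric])
qed

definition mean_phase :: "nat \<Rightarrow> (nat \<Rightarrow> real) \<Rightarrow> complex" where
  "mean_phase p x = (\<Sum>k<p. phase p ((cyclic_shift p ^^ k) x)) / of_nat p"

lemma sum_shifted_periodic:
  fixes W :: "nat \<Rightarrow> 'a::ab_group_add"
  assumes "W p = W 0"
  shows "(\<Sum>k<p. W (Suc k)) = (\<Sum>k<p. W k)"
proof -
  have "(\<Sum>k<p. W (Suc k)) + W 0 = (\<Sum>k<p. W k) + W p"
    by (metis add.commute sum.lessThan_Suc sum.lessThan_Suc_shift)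
  then show ?thesis using assms by simp
qed

text \<open>
  Consecutive terms \<open>phase p ((cyclic_shift p ^^ k) x)\<close> cancel unless \<open>x k \<noteq> 0\<close>,
  which happens for at most \<open>n + 1\<close> values of \<open>k\<close>.
\<close>

lemma norm_mean_phase_le:
  assumes "x \<in> realization (skeleton p n)"
  shows "norm (mean_phase p x) \<le> real (n + 1) / real p"
proof (cases "p = 0")
  case False
  note x = realization_skeletonD[OF assms]
  define W where "W k = phase p ((cyclic_shift p ^^ k) x)" for k
  have "W p = W 0" by (simp add: W_def cyclic_shift_period)
  \<comment> \<open>The orbit closes up, so twice its sum is the sum over consecutive pairs.\<close>
  then have "2 * (\<Sum>k<p. W k) = (\<Sum>k<p. W k + W (Suc k))"
    by (simp add: sum.distrib sum_shifted_periodic)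
  also have "norm \<dots> \<le> (\<Sum>k<p. if k \<in> support x then 2 else 0)"
  proof (rule sum_norm_le)
    fix k assume k: "k \<in> {..<p}"
    show "norm (W k + W (Suc k)) \<le> (if k \<in> support x then 2 else 0)"
    proof (cases "k \<in> support x")
      case True
      have "norm (W k) = 1" "norm (W (Suc k)) = 1" by (simp_all add: W_def phase_def)
      then show ?thesis using True norm_triangle_ineq[of "W k" "W (Suc k)"] by simp
    next
      case False
      have "(cyclic_shift p ^^ k) x 0 = 0"
        using False k by (simp add: funpow_cyclic_shift support_def)
      then have "W (Suc k) = - W k"
        using phase_cyclic_shift[OF funpow_cyclic_shift_in[OF assms]] \<open>p \<noteq> 0\<close> by (simp add: W_def)
      then show ?thesis using False by simp
    qed
  qed
  also have "\<dots> = 2 * real (card (support x))"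
    using x(2) by (simp add: sum.If_cases Int_absorb1)
  also have "\<dots> \<le> 2 * real (n + 1)" using x(3) by simp
  finally have "norm (\<Sum>k<p. W k) \<le> real (n + 1)" by (simp add: norm_mult)
  then show ?thesis
    unfolding mean_phase_def W_def[symmetric] by (simp add: norm_divide divide_right_mono)
qed (simp add: mean_phase_def)

definition step :: "nat \<Rightarrow> (nat \<Rightarrow> real) \<Rightarrow> complex" where
  "step p x = phase p x - mean_phase p x"

text \<open>An explicit primitive of \<open>step\<close> along orbits: as the orbit sums vanish, it
  is minus the average of the partial sums over \<open>l < k\<close> for \<open>k < p\<close>.
  Averaging gives a formula that is continuous on the whole space.\<close>

definition potential :: "nat \<Rightarrow> (nat \<Rightarrow> real) \<Rightarrow> complex" where
  "potential p x = (\<Sum>k<p. of_nat k * step p ((cyclic_shift p ^^ k) x)) / of_nat p"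

lemma mean_phase_cyclic_shift: "mean_phase p (cyclic_shift p x) = mean_phase p x"
proof -
  define W where "W k = phase p ((cyclic_shift p ^^ k) x)" for k
  have "phase p ((cyclic_shift p ^^ k) (cyclic_shift p x)) = W (Suc k)" for k
    by (simp add: W_def funpow_swap1)
  moreover have "W p = W 0" by (simp add: W_def cyclic_shift_period)
  ultimately show ?thesis
    using sum_shifted_periodic[of W p] by (simp add: mean_phase_def W_def)
qed

lemma potential_cyclic_shift:
  assumes "0 < p"
  shows "potential p (cyclic_shift p x) - potential p x = step p x"
proof -
  define W where "W k = step p ((cyclic_shift p ^^ k) x)" for k
  have per: "W p = W 0" by (simp add: W_def cyclic_shift_period)
  have m: "mean_phase p ((cyclic_shift p ^^ k) x) = mean_phase p x" for k
    by (induction k) (simp_all add: mean_phase_cyclic_shift)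
  \<comment> \<open>Subtracting the orbit mean makes the orbit sum vanish, as any coboundary
    requires.\<close>
  have 0: "(\<Sum>k<p. W (Suc k)) = 0"
    unfolding sum_shifted_periodic[of W p, OF per] using assms
    by (simp add: W_def step_def m sum_subtractf) (simp add: mean_phase_def)
  \<comment> \<open>Summation by parts; at \<open>q = p\<close> the second sum vanishes and the
    boundary term is \<open>p\<close> times \<open>W p = W 0\<close>.\<close>
  have "(\<Sum>k<q. of_nat k * W (Suc k)) + (\<Sum>k<q. W (Suc k)) = (\<Sum>k<q. of_nat k * W k) + of_nat q * W q"
    for q
    by (induction q) (simp_all add: algebra_simps)
  from this[of p] have "(\<Sum>k<p. of_nat k * W (Suc k)) - (\<Sum>k<p. of_nat k * W k) = of_nat p * W 0"
    unfolding 0 per by (simp add: algebra_simps)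
  then have "(\<Sum>k<p. of_nat k * W (Suc k)) / of_nat p - (\<Sum>k<p. of_nat k * W k) / of_nat p = W 0"
    using assms by (simp add: diff_divide_distrib[symmetric])
  moreover have "step p ((cyclic_shift p ^^ k) (cyclic_shift p x)) = W (Suc k)" for k
    by (simp add: W_def funpow_swap1)
  ultimately show ?thesis by (simp add: potential_def W_def)
qed

lemma continuous_on_potential: "continuous_on X (potential p)"
proof -
  have ph: "continuous_on Y (\<lambda>x. phase p ((cyclic_shift p ^^ k) x))" for Y k
    unfolding phase_def
    by (intro continuous_on_cis continuous_on_mult_left continuous_on_sum
        continuous_on_product_then_coordinatewise[OF continuous_on_funpow_cyclic_shift])
  have "continuous_on UNIV (phase p)" using ph[of UNIV 0] by simp
  then have st: "continuous_on UNIV (step p)"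
    unfolding step_def mean_phase_def divide_inverse
    by (intro continuous_on_diff continuous_on_mult_right continuous_on_sum ph)
  have "continuous_on X (\<lambda>x. step p ((cyclic_shift p ^^ k) x))" for k
    by (rule continuous_on_compose2[OF st continuous_on_funpow_cyclic_shift]) simp
  then show ?thesis
    unfolding potential_def divide_inverse
    by (intro continuous_on_mult_left continuous_on_mult_right continuous_on_sum)
qed

section \<open>Equivariant maps into the periodic points\<close>

lemma dist_abs_circ: "dist (abs_circ a) (abs_circ b) = real_rho a b"
  by (rule dist_circ.abs_eq)

lemma dist_abs_circ_le: "dist (abs_circ a) (abs_circ b) \<le> \<bar>a - b\<bar>"
  unfolding dist_abs_circ using real_rho_le[of a b 0] by simp

text \<open>Subtracting a nonzero multiple of 2 from \<open>a - b\<close> leaves at least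
  \<open>2 - \<bar>a - b\<bar>\<close> in absolute value, so the upper bound excludes closeness by
  wrapping around.\<close>

lemma le_dist_abs_circ:
  assumes "\<delta> \<le> \<bar>a - b\<bar>" "\<bar>a - b\<bar> \<le> 2 - \<delta>"
  shows "\<delta> \<le> dist (abs_circ a) (abs_circ b)"
proof -
  obtain n :: int where n: "real_rho a b = \<bar>a - b - 2 * of_int n\<bar>"
    using real_rho_attained by blast
  show ?thesis
  proof (cases "n = 0")
    case False
    then have "1 \<le> \<bar>real_of_int n\<bar>" by simp
    then have "2 - \<bar>a - b\<bar> \<le> \<bar>a - b - 2 * of_int n\<bar>" by arith
    then show ?thesis unfolding dist_abs_circ n using assms by linarith
  qed (use assms n in \<open>simp add: dist_abs_circ\<close>)
qed

lemma continuous_on_abs_circ: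
  assumes "continuous_on X f"
  shows "continuous_on X (\<lambda>x. abs_circ (f x))"
proof (unfold continuous_on_def, intro ballI)
  fix x assume "x \<in> X"
  then have "((\<lambda>y. \<bar>f y - f x\<bar>) \<longlongrightarrow> \<bar>f x - f x\<bar>) (at x within X)"
    using assms unfolding continuous_on_def by (intro tendsto_intros) auto
  then have "((\<lambda>y. \<bar>f y - f x\<bar>) \<longlongrightarrow> 0) (at x within X)" by simp
  then have "((\<lambda>y. dist (abs_circ (f y)) (abs_circ (f x))) \<longlongrightarrow> 0) (at x within X)"
    by (rule tendsto_sandwich[OF _ _ tendsto_const, rotated 2])
      (auto intro: always_eventually dist_abs_circ_le)
  then show "((\<lambda>y. abs_circ (f y)) \<longlongrightarrow> abs_circ (f x)) (at x within X)"
    by (subst tendsto_dist_iff)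
qed

definition torus_point :: "'n \<Rightarrow> 'n \<Rightarrow> complex \<Rightarrow> circ ^ 'n" where
  "torus_point i j z = (\<chi> l. abs_circ (if l = i then Re z else if l = j then Im z else 0))"

lemma continuous_on_torus_point:
  assumes "continuous_on X f"
  shows "continuous_on X (\<lambda>x. torus_point i j (f x))"
  unfolding torus_point_def
proof (rule continuous_on_vec_lambda)
  fix l
  show "continuous_on X (\<lambda>x. abs_circ (if l = i then Re (f x) else if l = j then Im (f x) else 0))"
    by (rule continuous_on_abs_circ)
      (cases "l = i"; cases "l = j"; simp add: assms continuous_on_Re continuous_on_Im)
qed

lemma dist_le_rhoN: "dist (x $ i) (y $ i) \<le> rhoN x y"
  unfolding rhoN_def by (rule Max_ge) auto

text \<open>Were both coordinate differences below 1/2, the squared norm would be at most 1/2, less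
  than 9/16. Since 5/4 is below \<open>2 - \<delta>\<close>, no wrapping occurs.\<close>

lemma le_rhoN_torus_point:
  fixes i j :: "'n::finite"
  assumes "i \<noteq> j" "\<delta> < 1/2" "3/4 \<le> norm (z - w)" "norm (z - w) \<le> 5/4"
  shows "\<delta> \<le> rhoN (torus_point i j z) (torus_point i j w)"
proof -
  have le: "\<bar>Re z - Re w\<bar> \<le> 5/4" "\<bar>Im z - Im w\<bar> \<le> 5/4"
    using abs_Re_le_cmod[of "z - w"] abs_Im_le_cmod[of "z - w"] assms(4) by simp_all
  have "\<delta> \<le> \<bar>Re z - Re w\<bar> \<or> \<delta> \<le> \<bar>Im z - Im w\<bar>"
  proof (rule ccontr)
    assume "\<not> ?thesis"
    then have "\<bar>Re z - Re w\<bar> \<le> 1/2" "\<bar>Im z - Im w\<bar> \<le> 1/2" using assms(2) by linarith+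
    then have "(Re z - Re w) ^ 2 \<le> (1/2) ^ 2" "(Im z - Im w) ^ 2 \<le> (1/2) ^ 2"
      by (subst power2_le_iff_abs_le; simp)+
    then have "norm (z - w) ^ 2 \<le> 1/2"
      unfolding cmod_power2 by (simp add: power_divide)
    moreover have "(3/4) ^ 2 \<le> norm (z - w) ^ 2" using assms(3) by (intro power_mono) auto
    ultimately show False by (simp add: power2_eq_square)
  qed
  then show ?thesis
  proof
    assume "\<delta> \<le> \<bar>Re z - Re w\<bar>"
    then have "\<delta> \<le> dist (torus_point i j z $ i) (torus_point i j w $ i)"
      using le assms(2) by (simp add: torus_point_def le_dist_abs_circ)
    then show ?thesis using dist_le_rhoN order_trans by blast
  next
    assume "\<delta> \<le> \<bar>Im z - Im w\<bar>"
    then have "\<delta> \<le> dist (torus_point i j z $ j) (torus_point i j w $ j)"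
      using le assms(1,2) by (simp add: torus_point_def le_dist_abs_circ)
    then show ?thesis using dist_le_rhoN order_trans by blast
  qed
qed

text \<open>A unit vector is changed by the orbit mean, whose norm is at most
  \<open>(n + 1) / p \<le> 1/4\<close>.\<close>

lemma norm_step:
  assumes "x \<in> realization (skeleton p n)" "4 * (n + 1) \<le> p"
  shows "3/4 \<le> norm (step p x)" "norm (step p x) \<le> 5/4"
proof -
  have "real (4 * (n + 1)) \<le> real p" using assms(2) by (rule of_nat_mono)
  then have "real (n + 1) / real p \<le> 1/4" using assms(2) by (simp add: field_simps)
  then have m: "norm (mean_phase p x) \<le> 1/4" using norm_mean_phase_le[OF assms(1)] by linarith
  have "norm (phase p x) = 1" by (simp add: phase_def)
  then show "3/4 \<le> norm (step p x)" "norm (step p x) \<le> 5/4"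
    using m norm_triangle_ineq2[of "phase p x" "mean_phase p x"]
      norm_triangle_ineq4[of "phase p x" "mean_phase p x"]
    unfolding step_def by linarith+
qed

section \<open>The equivariant map and the coindex bound\<close>

text \<open>The two-sided itinerary of \<open>x\<close>. Reducing the time modulo \<open>p\<close>
  turns it into a natural exponent and makes the sequence periodic by construction.\<close>

definition orbit_map :: "'n \<Rightarrow> 'n \<Rightarrow> nat \<Rightarrow> (nat \<Rightarrow> real) \<Rightarrow> int \<Rightarrow> circ ^ 'n" where
  "orbit_map i j p x = (\<lambda>k. torus_point i j (potential p ((cyclic_shift p ^^ nat (k mod int p)) x)))"

text \<open>When \<open>k mod p = p - 1\<close> the reduced exponent falls back to 0, which the
  period of the shift absorbs.\<close>

lemma orbit_map_Suc:
  assumes "0 < p"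
  shows "orbit_map i j p x (k + 1) =
    torus_point i j (potential p (cyclic_shift p ((cyclic_shift p ^^ nat (k mod int p)) x)))"
proof -
  have "nat ((k + 1) mod int p) = Suc (nat (k mod int p)) mod p"
  proof -
    have "(k + 1) mod int p = int (Suc (nat (k mod int p)) mod p)"
      using assms by (simp add: zmod_int mod_add_right_eq add.commute)
    then show ?thesis by simp
  qed
  then have "(cyclic_shift p ^^ nat ((k + 1) mod int p)) x = (cyclic_shift p ^^ Suc (nat (k mod int p))) x"
    using funpow_mod_eq[OF cyclic_shift_period] by metis
  then show ?thesis by (simp add: orbit_map_def)
qed

lemma equivariant_orbit_map:
  fixes i j :: "'n::finite"
  assumes "i \<noteq> j" "\<delta> < 1/2" "4 * (n + 1) \<le> p"
  shows "equivariant_map (realization_space (skeleton p n)) (cyclic_shift p)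
    (top_of_set (periodic_points p (XS \<delta>))) left_shift (orbit_map i j p)"
proof -
  let ?X = "realization (skeleton p n)"
  have p: "0 < p" using assms(3) by simp
  have "continuous_on ?X (orbit_map i j p)"
    unfolding orbit_map_def
  proof (rule continuous_on_coordinatewise_then_product)
    fix k
    show "continuous_on ?X
        (\<lambda>x. torus_point i j (potential p ((cyclic_shift p ^^ nat (k mod int p)) x)))"
      by (intro continuous_on_torus_point
          continuous_on_compose2[OF continuous_on_potential continuous_on_funpow_cyclic_shift])
        (rule subset_UNIV)
  qed
  moreover have "orbit_map i j p x \<in> periodic_points p (XS \<delta>)" if x: "x \<in> ?X" for x
  proof -
    have "\<delta> \<le> rhoN (orbit_map i j p x k) (orbit_map i j p x (k + 1))" for k
    proof -
      define y where "y = (cyclic_shift p ^^ nat (k mod int p)) x"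
      have y: "y \<in> ?X" unfolding y_def by (rule funpow_cyclic_shift_in[OF x])
      have s: "norm (potential p y - potential p (cyclic_shift p y)) = norm (step p y)"
        unfolding potential_cyclic_shift[OF p, symmetric] by (rule norm_minus_commute)
      have "3/4 \<le> norm (potential p y - potential p (cyclic_shift p y))"
        "norm (potential p y - potential p (cyclic_shift p y)) \<le> 5/4"
        unfolding s by (rule norm_step[OF y assms(3)])+
      then show ?thesis
        unfolding orbit_map_Suc[OF p] y_def[symmetric]
        unfolding orbit_map_def y_def[symmetric]
        by (rule le_rhoN_torus_point[OF assms(1,2)])
    qed
    moreover have "orbit_map i j p x (k + int p) = orbit_map i j p x k" for k
      by (simp add: orbit_map_def)
    ultimately show ?thesis
      by (simp add: periodic_points_def XS_def left_shift_funpow)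
  qed
  moreover have "orbit_map i j p (cyclic_shift p x) = left_shift (orbit_map i j p x)" for x
    unfolding left_shift_def orbit_map_Suc[OF p] by (simp add: orbit_map_def funpow_swap1)
  ultimately show ?thesis
    unfolding equivariant_map_def by (simp add: continuous_map_subtopology_eu image_subset_iff_funcset Pi_iff)
qed

lemma le_coind:
  fixes \<delta> :: real
  assumes "CARD('n::finite) \<ge> 2" "\<delta> < 1/2" "4 * (n + 1) \<le> p"
  shows "ereal (real n) \<le>
    coind p (top_of_set (periodic_points p (XS \<delta> :: (int \<Rightarrow> circ ^ 'n) set))) left_shift"
proof -
  let ?P = "periodic_points p (XS \<delta> :: (int \<Rightarrow> circ ^ 'n) set)"
  \<comment> \<open>Two distinct torus coordinates are needed for the real and imaginary parts; here
    \<open>N \<ge> 2\<close> enters.\<close>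
  obtain i j :: 'n where ij: "i \<noteq> j"
  proof -
    have "\<not> card (UNIV :: 'n set) \<le> Suc 0" using assms(1) by simp
    then show thesis using that card_le_Suc0_iff_eq[OF finite] by blast
  qed
  have E: "E_space p n (skeleton p n) (cyclic_shift p)" using assms(3) by (intro E_space_skeleton) simp
  have e: "equivariant_map (realization_space (skeleton p n)) (cyclic_shift p)
      (top_of_set ?P) left_shift (orbit_map i j p)"
    by (rule equivariant_orbit_map[OF ij assms(2,3)])
  \<comment> \<open>The image of a vertex shows that there are periodic points, which rules out the
    value -1 of \<open>coind\<close>.\<close>
  have "(\<lambda>v. if v = 0 then 1 else 0) \<in> realization (skeleton p n)"
  proof (rule realization_skeletonI)
    have "support (\<lambda>v. if v = 0 then 1 else 0) = {0}" by (auto simp: support_def)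
    then show "support (\<lambda>v. if v = 0 then 1 else 0) \<subseteq> {..<p}"
      "card (support (\<lambda>v. if v = 0 then 1 else 0)) \<le> n + 1"
      using assms(3) by simp_all
  qed (use assms(3) in simp_all)
  then have "topspace (top_of_set ?P) \<noteq> {}"
    using e unfolding equivariant_map_def continuous_map_def by auto
  then show ?thesis
    unfolding coind_def using E e by (simp only: if_False) (rule Sup_upper, blast)
qed

theorem mainTheorem2:
  fixes \<delta> :: real
  assumes "CARD('n::finite) \<ge> 2" and "0 < \<delta>" and "\<delta> < 1/2"
  shows "((\<lambda>p. coind p (top_of_set (periodic_points p (XS \<delta> :: (int \<Rightarrow> circ ^ 'n) set))) left_shift)
           \<longlongrightarrow> \<infinity>) (inf at_top (principal {p::nat. prime p}))"
  unfolding tendsto_PInfty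
proof
  fix r
  obtain n :: nat where n: "r < real n" using reals_Archimedean2 by blast
  have "ereal r < coind p (top_of_set (periodic_points p (XS \<delta> :: (int \<Rightarrow> circ ^ 'n) set))) left_shift"
    if "p \<ge> 4 * (n + 1)" for p
    using less_le_trans[of "ereal r" "ereal (real n)"] le_coind[OF assms(1,3) that] n by simp
  then show "\<forall>\<^sub>F p in inf at_top (principal {p. prime p}).
      ereal r < coind p (top_of_set (periodic_points p (XS \<delta> :: (int \<Rightarrow> circ ^ 'n) set))) left_shift"
    unfolding eventually_inf_principal eventually_at_top_linorder by blast
qed

end
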